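(* Let $\mathcal G^0=(\mathcal V,\mathcal E^0)$ be an undirected graph with $N$ vertices, $p\in[0,1]$, $\gamma>0$, and let $\hat G$ be the decomposable jump linear system with nominal communication graph $\mathcal G^0$, agent matrices $A^d,A^c\in\mathbb R^{n_x\times n_x}$, $B^d,B^c\in\mathbb R^{n_x\times n_w}$, $C^d,C^c\in\mathbb R^{n_z\times n_x}$, $D^d,D^c\in\mathbb R^{n_z\times n_w}$, and Bernoulli packet loss with transmission probability $p$ (as defined in the context). Let $\lambda_1,\dots,\lambda_N$ be the eigenvalues of $L^0=L(\mathcal G^0)$, and set $\bar A_i=A^d+p\lambda_iA^c$, $\bar B_i=B^d+p\lambda_iB^c$, $\bar C_i=C^d+p\lambda_iC^c$, $\bar D_i=D^d+p\lambda_iD^c$. If there exist a symmetric $Q\in\mathbb R^{n_x\times n_x}$ with $Q\succ0$ and symmetric $Z_1,\dots,Z_N\in\mathbb R^{n_w\times n_w}$ with $\sum_{i=1}^N\operatorname{tr}(Z_i)<\gamma^2$ such that $$\bar A_i^TQ\bar A_i+\bar C_i^T\bar C_i-Q+2p(1-p)\lambda_i\big(A^{cT}QA^c+C^{cT}C^c\big)\prec0,$$ $$\bar B_i^TQ\bar B_i+\bar D_i^T\bar D_i-Z_i+2p(1-p)\lambda_i\big(B^{cT}QB^c+D^{cT}D^c\big)\prec0$$ for all $i\in\{1,\dots,N\}$, then $\hat G$ is mean-square stable and $\|\hat G\|_{H_2}<\gamma$.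
   Context: Notation: $\otimes$ is the Kronecker product; $M\succ 0$ ($M\prec0$) means that the symmetric matrix $M$ is positive (negative) definite; $A^{cT}=(A^c)^T$ and similarly for the other matrices. Graphs: a graph $\mathcal G=(\mathcal V,\mathcal E)$ has vertex set $\mathcal V=\{v_1,\dots,v_N\}$ and edge set $\mathcal E\subset\mathcal V\times\mathcal V$ without self-loops; $e_{ij}=(v_j,v_i)$ is the edge from $v_j$ to $v_i$; $\mathcal G$ is undirected if $e_{ij}\in\mathcal E\Leftrightarrow e_{ji}\in\mathcal E$. The in-neighbourhood is $\mathcal N_i^-=\{v_j: e_{ij}\in\mathcal E\}$, with $d_i^-=|\mathcal N_i^-|$. The Laplacian $L(\mathcal G)=[l_{ij}]$ has $l_{ij}=-1$ if $i\ne j$ and $v_j\in\mathcal N_i^-$, $l_{ij}=0$ if $i\neq j$ and $v_j\notin\mathcal N_i^-$, and $l_{ii}=d_i^-$. Packet loss model: to each edge $e_{ij}\in\mathcal E^0$ is attached a stationary process $\alpha_{ij}(k)\in\{0,1\}$, $k\ge0$ ($1$: packet transmitted, $0$: packet lost), independent in time, with $\Pr(\alpha_{ij}(k)=1)=p$ and $\Pr(\alpha_{ij}(k)=0)=1-p$. The variables $\alpha_{ij}(k)$ and $\alpha_{rs}(k')$ are independent whenever $k\ne k'$ or [$(r,s)\neq(i,j)$ and $(r,s)\ne(j,i)$] (so losses on opposing links $e_{ij}$, $e_{ji}$ may be correlated, and need not be equal). The mode $\sigma(k)\in\mathcal K=\{1,\dots,2^{|\mathcal E^0|}\}$ encodes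 bijectively the values $(\alpha_{ij}(k))_{e_{ij}\in\mathcal E^0}$; $\mathcal G_i=(\mathcal V,\mathcal E_i)$, where $\mathcal E_i\subseteq\mathcal E^0$ is the set of edges active ($\alpha=1$) in mode $i$, and $L_i=L(\mathcal G_i)$. Thus $\sigma(k)$ are independent over time with $\Pr(\sigma(k)=i)=t_i$, the probability of the corresponding loss pattern; when an initial distribution $\sigma_0$ (or value) is prescribed, it governs $\sigma(0)$, and $\Pr(\sigma(k)=i)=t_i$ independently for $k\ge1$. Decomposable jump linear system $\hat G$: $$x(k+1)=(I_N\otimes A^d+L_{\sigma(k)}\otimes A^c)x(k)+(I_N\otimes B^d+L_{\sigma(k)}\otimes B^c)w(k),$$ $$z(k)=(I_N\otimes C^d+L_{\sigma(k)}\otimes C^c)x(k)+(I_N\otimes D^d+L_{\sigma(k)}\otimes D^c)w(k),$$ with $x(k)\in\mathbb R^{Nn_x}$, $w(k)\in\mathbb R^{Nn_w}$, $z(k)\in\mathbb R^{Nn_z}$, $x(0)=x_0$. Mean-square stability: with $w\equiv0$, $\lim_{k\to\infty}\mathbb E[\|x(k)\|]=0$ and $\lim_{k\to\infty}\mathbb E[\|x(k)x^T(k)\|]=0$ for all initial conditions $x_0$ and all initial distributions $\sigma_0$. $H_2$-norm: for mean-square stable $\hat G$, $\|\hat G\|_{H_2}^2=\sum_{i\in\mathcal K}\sum_{s=1}^{Nn_w}t_i\|z^{s,i}\|^2$, where $z^{s,i}$ is the output for $x_0=0$, $\sigma(0)=i$, and a discrete unit impulse in the $s$-th input ($w(0)=$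 the $s$-th standard basis vector, $w(k)=0$ for $k\ge1$), and $\|z\|^2=\sum_{k=0}^\infty\mathbb E[z^T(k)z(k)]$. *)

theory Defs
  imports "HOL-Probability.Probability"
begin

section \<open>Matrices\<close>

text \<open>With rows and columns indexed by pairs, the index \<open>(i, a)\<close> is entry \<open>a\<close> of block \<open>i\<close>;
  \<open>real ^ ('n \<times> 'x)\<close> plays the role of the space of dimension \<open>N n\<^sub>x\<close>.\<close>

definition kronecker :: "real^'b^'a \<Rightarrow> real^'d^'c \<Rightarrow> real^('b \<times> 'd)^('a \<times> 'c)"
    (infixl \<open>\<otimes>\<^sub>K\<close> 75)
  where "A \<otimes>\<^sub>K B = (\<chi> r c. A $ fst r $ fst c * B $ snd r $ snd c)"

definition outer :: "real^'a \<Rightarrow> real^'a^'a"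
  where "outer v = (\<chi> i j. v $ i * v $ j)"

definition pos_definite :: "real^'a^'a \<Rightarrow> bool"
  where "pos_definite M \<longleftrightarrow> transpose M = M \<and> (\<forall>v. v \<noteq> 0 \<longrightarrow> v \<bullet> (M *v v) > 0)"

definition neg_definite :: "real^'a^'a \<Rightarrow> bool"
  where "neg_definite M \<longleftrightarrow> transpose M = M \<and> (\<forall>v. v \<noteq> 0 \<longrightarrow> v \<bullet> (M *v v) < 0)"

text \<open>The family \<open>lam\<close> lists all eigenvalues of \<open>L\<close> with algebraic multiplicity: the characteristic
  polynomial \<open>det (s I - L)\<close> splits into the linear factors \<open>s - lam i\<close>.\<close>

definition eigenvalue_family :: "real^'n^'n \<Rightarrow> ('n \<Rightarrow> real) \<Rightarrow> bool"
  where "eigenvalue_family L lam \<longleftrightarrow> (\<forall>s. det (mat s - L) = (\<Prod>i\<in>UNIV. s - lam i))"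

section \<open>Graphs\<close>

text \<open>The vertex set is the index type \<open>'n\<close>; the pair \<open>(j, i)\<close> is the edge from \<open>j\<close> to \<open>i\<close>.\<close>

definition in_neighbours :: "('n \<times> 'n) set \<Rightarrow> 'n \<Rightarrow> 'n set"
  where "in_neighbours E i = {j. (j, i) \<in> E}"

definition laplacian :: "('n \<times> 'n) set \<Rightarrow> real^'n^'n"
  where "laplacian E = (\<chi> i j.
    if i = j then real (card (in_neighbours E i))
    else if j \<in> in_neighbours E i then -1 else 0)"

section \<open>Bernoulli packet loss\<close>

text \<open>A mode is identified with its set of active edges, so the set of modes is \<open>Pow E\<close>.\<close>

definition active_edges :: "'e set \<Rightarrow> ('e \<Rightarrow> nat \<Rightarrow> 'a \<Rightarrow> bool) \<Rightarrow> nat \<Rightarrow> 'a \<Rightarrow> 'e set"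
  where "active_edges E \<alpha> k \<omega> = {e \<in> E. \<alpha> e k \<omega>}"

text \<open>\<open>\<alpha> e k \<omega>\<close> is true iff the packet sent over \<open>e\<close> at time \<open>k\<close> is transmitted. Modes at different
  times are mutually independent. At a fixed time, only pairwise independence of losses is
  required, and opposing links may be arbitrarily correlated.\<close>

locale bernoulli_packet_loss = prob_space M
  for M :: "'a measure"
    and E :: "('n::finite \<times> 'n) set"
    and p :: real
    and \<alpha> :: "'n \<times> 'n \<Rightarrow> nat \<Rightarrow> 'a \<Rightarrow> bool" +
  assumes random: "e \<in> E \<Longrightarrow> random_variable (count_space UNIV) (\<alpha> e k)"
    and transmission: "e \<in> E \<Longrightarrow> prob {\<omega> \<in> space M. \<alpha> e k \<omega>} = p"
    and loss: "e \<in> E \<Longrightarrow> prob {\<omega> \<in> space M. \<not> \<alpha> e k \<omega>} = 1 - p"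
    and stationary:
      "distr M (count_space UNIV) (active_edges E \<alpha> k) =
       distr M (count_space UNIV) (active_edges E \<alpha> 0)"
    and indep_time: "indep_vars (\<lambda>_. count_space UNIV) (active_edges E \<alpha>) UNIV"
    and indep_links: "\<lbrakk>e \<in> E; f \<in> E; f \<noteq> e; f \<noteq> prod.swap e\<rbrakk> \<Longrightarrow>
      indep_var (count_space UNIV) (\<alpha> e k) (count_space UNIV) (\<alpha> f k)"

section \<open>Jump linear systems\<close>

text \<open>The functions \<open>A\<close>, \<open>B\<close>, \<open>C\<close>, \<open>D\<close> give the system matrices in each mode and \<open>s\<close> is a realisation
  of the mode process.\<close>

primrec jump_state ::
  "('m \<Rightarrow> real^'x^'x) \<Rightarrow> ('m \<Rightarrow> real^'w^'x) \<Rightarrow> (nat \<Rightarrow> 'm) \<Rightarrow> (nat \<Rightarrow> real^'w) \<Rightarrow> real^'x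
    \<Rightarrow> nat \<Rightarrow> real^'x"
  where
    "jump_state A B s w x0 0 = x0"
  | "jump_state A B s w x0 (Suc k) = A (s k) *v jump_state A B s w x0 k + B (s k) *v w k"

definition jump_output ::
  "('m \<Rightarrow> real^'x^'x) \<Rightarrow> ('m \<Rightarrow> real^'w^'x) \<Rightarrow> ('m \<Rightarrow> real^'x^'z) \<Rightarrow> ('m \<Rightarrow> real^'w^'z)
    \<Rightarrow> (nat \<Rightarrow> 'm) \<Rightarrow> (nat \<Rightarrow> real^'w) \<Rightarrow> real^'x \<Rightarrow> nat \<Rightarrow> real^'z"
  where "jump_output A B C D s w x0 k = C (s k) *v jump_state A B s w x0 k + D (s k) *v w k"

text \<open>A prescribed initial distribution \<open>\<mu>\<close> is realised by drawing \<open>\<sigma> 0\<close> from \<open>\<mu>\<close> independently of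
  \<open>\<sigma> k\<close>, \<open>k \<ge> 1\<close>, on a product space. The matrix norm below is the Frobenius norm.\<close>

definition mean_square_stable ::
  "'a measure \<Rightarrow> (nat \<Rightarrow> 'a \<Rightarrow> 'm) \<Rightarrow> 'm set \<Rightarrow> ('m \<Rightarrow> real^'x^'x) \<Rightarrow> ('m \<Rightarrow> real^'w^'x) \<Rightarrow> bool"
  where "mean_square_stable M \<sigma> K A B \<longleftrightarrow>
    (\<forall>x0 \<mu>. set_pmf \<mu> \<subseteq> K \<longrightarrow>
      (let x = (\<lambda>k (i, \<omega>). jump_state A B ((\<lambda>l. \<sigma> l \<omega>)(0 := i)) (\<lambda>_. 0) x0 k) in
        (\<lambda>k. \<integral>y. norm (x k y) \<partial>(measure_pmf \<mu> \<Otimes>\<^sub>M M)) \<longlonglongrightarrow> 0 \<and>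
        (\<lambda>k. \<integral>y. norm (outer (x k y)) \<partial>(measure_pmf \<mu> \<Otimes>\<^sub>M M))
          \<longlonglongrightarrow> 0))"

text \<open>The energies are extended nonnegative reals, so a divergent series gives \<open>\<infinity>\<close>; in particular
  a bound on the norm below includes convergence.\<close>

definition output_energy :: "'a measure \<Rightarrow> (nat \<Rightarrow> 'a \<Rightarrow> real^'z) \<Rightarrow> ennreal"
  where "output_energy M z = (\<Sum>k. \<integral>\<^sup>+\<omega>. ennreal (z k \<omega> \<bullet> z k \<omega>) \<partial>M)"

definition impulse :: "'w \<Rightarrow> nat \<Rightarrow> real^'w"
  where "impulse s k = (if k = 0 then axis s 1 else 0)"

definition h2_norm_squared ::
  "'a measure \<Rightarrow> (nat \<Rightarrow> 'a \<Rightarrow> 'm) \<Rightarrow> 'm set \<Rightarrow> ('m \<Rightarrow> real^'x^'x) \<Rightarrow> ('m \<Rightarrow> real^'w^'x)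
    \<Rightarrow> ('m \<Rightarrow> real^'x^'z) \<Rightarrow> ('m \<Rightarrow> real^'w^'z) \<Rightarrow> ennreal"
  where "h2_norm_squared M \<sigma> K A B C D =
    (\<Sum>i\<in>K. \<Sum>s\<in>UNIV. ennreal (measure M {\<omega> \<in> space M. \<sigma> 0 \<omega> = i}) *
      output_energy M
        (\<lambda>k \<omega>. jump_output A B C D ((\<lambda>l. \<sigma> l \<omega>)(0 := i)) (impulse s) 0 k))"

definition h2_norm ::
  "'a measure \<Rightarrow> (nat \<Rightarrow> 'a \<Rightarrow> 'm) \<Rightarrow> 'm set \<Rightarrow> ('m \<Rightarrow> real^'x^'x) \<Rightarrow> ('m \<Rightarrow> real^'w^'x)
    \<Rightarrow> ('m \<Rightarrow> real^'x^'z) \<Rightarrow> ('m \<Rightarrow> real^'w^'z) \<Rightarrow> ennreal"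
  where "h2_norm M \<sigma> K A B C D =
    (let S = h2_norm_squared M \<sigma> K A B C D
     in if S = \<infinity> then \<infinity> else ennreal (sqrt (enn2real S)))"

section \<open>Decomposable systems\<close>

definition decomposable ::
  "real^'b^'a \<Rightarrow> real^'b^'a \<Rightarrow> ('n::finite \<times> 'n) set \<Rightarrow> real^('n \<times> 'b)^('n \<times> 'a)"
  where "decomposable Md Mc E = mat 1 \<otimes>\<^sub>K Md + laplacian E \<otimes>\<^sub>K Mc"

end

theory Submission
  imports Defs
begin

text \<open>The Lyapunov function is \<open>V x = \<Sum>\<^sub>i x\<^sub>i\<^sup>T Q x\<^sub>i\<close>, summed over the blocks of the state. The rows of
  the random Laplacian consist of pairwise uncorrelated links, and opposing links never occur in
  the same row, so \<open>E[L\<^sup>T L] = p\<^sup>2 L\<^sub>0\<^sup>2 + 2 p (1 - p) L\<^sub>0\<close>: the variance is the Dirichlet form, which for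
  an undirected graph is given by \<open>2 L\<^sub>0\<close>. Expanding in an orthonormal eigenbasis of \<open>L\<^sub>0\<close> decouples
  the expected dissipation into one quadratic form per eigenvalue, namely the one in the first
  matrix inequality. Hence \<open>E V\<close> decays geometrically, and the output energy after time 0 is at
  most the expected value of \<open>V\<close> at time 1. In the same way the second inequality bounds
  the energy of the impulse responses; summed over all impulses, the bound is
  \<open>\<Sum>\<^sub>i tr Z\<^sub>i\<close> by orthogonality of the eigenbasis.\<close>

section \<open>Orthonormal eigenvectors of symmetric matrices\<close>

lemma symmetric_matrix_inner:
  fixes S :: "real^'a^'a"
  assumes "transpose S = S"
  shows "u \<bullet> (S *v v) = (S *v u) \<bullet> v"
  by (metis assms dot_lmul_matrix vector_transpose_matrix inner_commute)

text \<open>A maximiser \<open>v\<close> of the Rayleigh quotient on the unit sphere of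
  \<open>S\<close> works. With \<open>m\<close> the maximum, the symmetric form \<open>g\<close> is
  nonnegative on \<open>S\<close> and vanishes at \<open>v\<close>, which forces
  \<open>g v y = 0\<close> for all \<open>y\<close> in \<open>S\<close>; invariance of
  \<open>S\<close> then permits \<open>y = m *\<^sub>R v - f v\<close>.\<close>

lemma selfadjoint_has_eigenvector:
  fixes f :: "'v::euclidean_space \<Rightarrow> 'v"
  assumes f: "linear f" and adj: "\<And>x y. x \<bullet> f y = f x \<bullet> y"
    and S: "subspace S" "\<And>x. x \<in> S \<Longrightarrow> f x \<in> S" "S \<noteq> {0}"
  obtains v m where "v \<in> S" "norm v = 1" "f v = m *\<^sub>R v"
proof -
  let ?K = "S \<inter> sphere 0 1"
  have "compact ?K"
    using closed_subspace[OF S(1)] by (simp add: closed_Int_compact)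
  moreover obtain s where s: "s \<in> S" "s \<noteq> 0"
    using S(1,3) subspace_0 by blast
  have "s /\<^sub>R norm s \<in> ?K"
    using s S(1) by (simp add: subspace_scale)
  then have "?K \<noteq> {}" by blast
  moreover have "continuous_on ?K (\<lambda>x. x \<bullet> f x)"
    by (intro continuous_intros linear_continuous_on linear_conv_bounded_linear[THEN iffD1] f)
  ultimately obtain v where v: "v \<in> ?K" and max: "\<And>x. x \<in> ?K \<Longrightarrow> x \<bullet> f x \<le> v \<bullet> f v"
    using continuous_attains_sup[of ?K "\<lambda>x. x \<bullet> f x"] by blast
  define m where "m = v \<bullet> f v"
  define g where "g x y = m * (x \<bullet> y) - x \<bullet> f y" for x y
  have vv: "v \<bullet> v = 1" "v \<in> S" using v by (auto simp: dot_square_norm)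
  have pos: "g x x \<ge> 0" if "x \<in> S" for x
  proof (cases "x = 0")
    case True
    then show ?thesis by (simp add: g_def)
  next
    case False
    have "x /\<^sub>R norm x \<in> ?K"
      using that False S(1) by (simp add: subspace_scale)
    from max[OF this] have "(x \<bullet> f x) / (norm x)\<^sup>2 \<le> m"
      using False by (simp add: m_def linear_scale[OF f] power2_eq_square field_simps)
    then show ?thesis
      using False by (simp add: g_def dot_square_norm field_simps)
  qed
  have gv: "g v v = 0" by (simp add: g_def m_def vv)
  have lin: "g (x + y) (x + y) = g x x + 2 * g x y + g y y" for x y
    using adj[of x y] by (simp add: g_def linear_add[OF f] inner_add algebra_simps inner_commute)
  have orth: "g v y = 0" if "y \<in> S" for y
  proof (rule ccontr)
    assume ne: "g v y \<noteq> 0"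
    \<comment> \<open>The parabola in \<open>t\<close> would be minimal at
      \<open>- g v y / g y y\<close>; the added 1 avoids a zero denominator and still leaves a
      negative value.\<close>
    define t where "t = - g v y / (g y y + 1)"
    have gy: "g y y \<ge> 0" using pos[OF that] .
    have "0 \<le> g (v + t *\<^sub>R y) (v + t *\<^sub>R y)"
      using that vv S(1) by (intro pos) (simp add: subspace_add subspace_scale)
    also have "\<dots> = 2 * t * g v y + t\<^sup>2 * g y y"
      unfolding lin gv by (simp add: g_def linear_scale[OF f] power2_eq_square algebra_simps)
    also have "\<dots> = - (g v y)\<^sup>2 * (g y y + 2) / (g y y + 1)\<^sup>2"
      using gy unfolding t_def by (simp add: divide_simps power2_eq_square) (simp add: algebra_simps)
    also have "\<dots> < 0"
      using ne gy by (intro divide_neg_pos mult_neg_pos) auto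
    finally show False by simp
  qed
  let ?y = "m *\<^sub>R v - f v"
  have "?y \<in> S" using S(1,2) vv by (simp add: subspace_diff subspace_scale)
  from orth[OF this] have "?y \<bullet> ?y = 0"
    unfolding g_def adj by (simp add: inner_diff_left)
  then have "f v = m *\<^sub>R v" by simp
  with that v show ?thesis by auto
qed

text \<open>Split off one unit eigenvector and induct on the dimension: by self-adjointness its
  orthogonal complement within \<open>S\<close> is again invariant. Invariant subspaces instead of
  the whole space make the induction go through.\<close>

lemma selfadjoint_orthonormal_eigenbasis:
  fixes f :: "'v::euclidean_space \<Rightarrow> 'v"
  assumes f: "linear f" and adj: "\<And>x y. x \<bullet> f y = f x \<bullet> y"
    and "subspace S" "\<And>x. x \<in> S \<Longrightarrow> f x \<in> S"
  shows "\<exists>B\<subseteq>S. finite B \<and> card B = dim S \<and> pairwise orthogonal B \<and>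
    (\<forall>b\<in>B. norm b = 1 \<and> (\<exists>m. f b = m *\<^sub>R b))"
  using assms(3,4)
proof (induction "dim S" arbitrary: S)
  case 0
  then show ?case by (intro exI[of _ "{}"]) simp
next
  case (Suc n)
  then have "S \<noteq> {0}" by auto
  then obtain v m where v: "v \<in> S" "norm v = 1" "f v = m *\<^sub>R v"
    using selfadjoint_has_eigenvector[OF f adj Suc.prems] by metis
  define T where "T = {y \<in> S. orthogonal v y}"
  have "dim {y \<in> S. \<forall>x\<in>span {v}. orthogonal x y} + dim (span {v}) = dim S"
    using v Suc.prems(1) by (intro dim_subspace_orthogonal_to_vectors) (simp_all add: span_minimal)
  moreover have "{y \<in> S. \<forall>x\<in>span {v}. orthogonal x y} = T"
    unfolding T_def by (auto simp: span_singleton orthogonal_def)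
  moreover have "dim {v} = 1"
    using v(2) by (subst dim_singleton) auto
  ultimately have dimT: "dim T = n" using Suc.hyps(2) by simp
  have subT: "subspace T"
    using Suc.prems(1) by (auto simp: T_def subspace_def orthogonal_def inner_add)
  have "f y \<in> T" if "y \<in> T" for y
    using that Suc.prems(2) v(3) adj[of v y] by (simp add: T_def orthogonal_def)
  from Suc.hyps(1)[OF dimT[symmetric] subT this] obtain B where
    B: "B \<subseteq> T" "finite B" "card B = n" "pairwise orthogonal B"
      "\<forall>b\<in>B. norm b = 1 \<and> (\<exists>m. f b = m *\<^sub>R b)" using dimT by metis
  have "v \<notin> B"
    using B(1) v(2) by (auto simp: T_def orthogonal_def)
  moreover have "pairwise orthogonal (insert v B)"
    using B(1,4) by (auto simp: pairwise_insert T_def orthogonal_commute)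
  ultimately show ?case
    using B v Suc.hyps(2) by (intro exI[of _ "insert v B"]) (auto simp: T_def)
qed

text \<open>Polynomials that agree as functions are equal and have the same multiset of roots; two
  families with the same multiset of values differ by a permutation of the indices.\<close>

lemma linear_factors_eq_imp_permutes:
  fixes a b :: "'n::finite \<Rightarrow> real"
  assumes "\<And>s. (\<Prod>i\<in>UNIV. s - a i) = (\<Prod>i\<in>UNIV. s - b i)"
  obtains \<pi> where "bij \<pi>" "\<And>i. b i = a (\<pi> i)"
proof -
  define P where "P c = (\<Prod>i\<in>UNIV. [:- c i, 1:])" for c :: "'n \<Rightarrow> real"
  have "poly (P a) = poly (P b)"
    using assms by (simp add: P_def poly_prod fun_eq_iff)
  then have eq: "P a = P b" by (simp add: poly_eq_poly_eq_iff)
  have "proots (P c) = image_mset c (mset_set UNIV)" for c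
    unfolding P_def by (subst proots_prod) (auto simp: sum_unfold_sum_mset)
  with eq have "image_mset a (mset_set UNIV) = image_mset b (mset_set UNIV)" by metis
  from image_mset_eq_implies_permutes[OF _ this[symmetric]]
  obtain \<pi> where "\<pi> permutes UNIV" "\<forall>i\<in>UNIV. b i = a (\<pi> i)" by auto
  then show ?thesis by (intro that[of \<pi>] permutes_bij) blast+
qed

text \<open>Some orthonormal eigenbasis exists, with eigenvalues \<open>\<mu>\<close> in an
  arbitrary order. Comparing characteristic polynomials matches \<open>\<mu>\<close> with
  \<open>lam\<close> up to a permutation, and reordering the basis makes row \<open>k\<close> belong
  to \<open>lam k\<close>.\<close>

lemma eigenvalue_family_orthonormal_eigenvectors:
  fixes L :: "real^'n^'n"
  assumes sym: "transpose L = L" and lam: "eigenvalue_family L lam"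
  obtains U :: "real^'n^'n"
  where "orthogonal_matrix U" "\<And>k. L *v row k U = lam k *\<^sub>R row k U"
proof -
  have "\<exists>B\<subseteq>UNIV. finite B \<and> card B = dim (UNIV :: (real^'n) set) \<and> pairwise orthogonal B \<and>
      (\<forall>b\<in>B. norm b = 1 \<and> (\<exists>m. L *v b = m *\<^sub>R b))"
    using symmetric_matrix_inner[OF sym]
    by (intro selfadjoint_orthonormal_eigenbasis) auto
  then obtain B where B: "finite B" "card B = CARD('n)" "pairwise orthogonal B"
    "\<And>b. b \<in> B \<Longrightarrow> norm b = 1" "\<And>b. b \<in> B \<Longrightarrow> \<exists>m. L *v b = m *\<^sub>R b"
    by (auto simp: dim_UNIV)
  obtain h where h: "bij_betw h (UNIV::'n set) B"
    using finite_same_card_bij[of "UNIV::'n set" B] B by auto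
  have hB: "h i \<in> B" for i using h by (auto simp: bij_betw_def)
  have h_inj: "h i = h j \<longleftrightarrow> i = j" for i j using h by (auto simp: bij_betw_def inj_def)
  obtain \<mu> where \<mu>: "\<And>i. L *v h i = \<mu> i *\<^sub>R h i" using B(5)[OF hB] by metis
  define W :: "real^'n^'n" where "W = (\<chi> i. h i)"
  have row_W: "row i W = h i" for i by (simp add: W_def row_def vec_eq_iff)
  have W: "orthogonal_matrix W"
    unfolding orthogonal_matrix_orthonormal_rows row_W
    using B(3,4) hB h_inj by (auto simp: pairwise_def)
  define D :: "real^'n^'n" where "D = (\<chi> i j. if i = j then \<mu> i else 0)"
  \<comment> \<open>Conjugation by the orthogonal matrix \<open>W\<close> turns \<open>L\<close>
    into the diagonal matrix \<open>D\<close>, so both have the same characteristic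
    polynomial.\<close>
  have WL: "W ** L = D ** W"
  proof -
    have "(W ** L) $ i $ j = (L *v h i) $ j" for i j
    proof -
      have "L $ k $ j = L $ j $ k" for k
        using arg_cong[OF sym, of "\<lambda>A. A $ j $ k"] by (simp add: transpose_def)
      then show ?thesis
        by (simp add: W_def matrix_matrix_mult_def matrix_vector_mult_def mult.commute[of "h i $ _"])
    qed
    moreover have "(D ** W) $ i $ j = \<mu> i * h i $ j" for i j
      by (simp add: D_def W_def matrix_matrix_mult_def if_distrib [of "\<lambda>x. x * _"] cong: if_cong)
    ultimately show ?thesis by (simp add: vec_eq_iff \<mu>)
  qed
  have "det (mat s - L) = (\<Prod>i\<in>UNIV. s - \<mu> i)" for s
  proof -
    have "W ** mat s = mat s ** W"
      by (simp add: vec_eq_iff matrix_matrix_mult_def mat_def if_distrib [of "\<lambda>x. _ * x"]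
          if_distrib [of "\<lambda>x. x * _"] cong: if_cong)
    then have "W ** (mat s - L) = (mat s - D) ** W"
      using WL \<open>W ** mat s = mat s ** W\<close>
      by (simp add: vec_eq_iff matrix_matrix_mult_def left_diff_distrib right_diff_distrib
          sum_subtractf)
    then have "det W * det (mat s - L) = det (mat s - D) * det W"
      by (metis det_mul)
    moreover have "det W \<noteq> 0"
      using det_orthogonal_matrix[OF W] by auto
    moreover have "det (mat s - D) = (\<Prod>i\<in>UNIV. s - \<mu> i)"
      by (subst det_diagonal) (auto simp: mat_def D_def)
    ultimately show ?thesis by simp
  qed
  with lam have "(\<Prod>i\<in>UNIV. s - \<mu> i) = (\<Prod>i\<in>UNIV. s - lam i)" for s
    by (simp add: eigenvalue_family_def)
  then obtain \<pi> where \<pi>: "bij \<pi>" "\<And>i. lam i = \<mu> (\<pi> i)"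
    using linear_factors_eq_imp_permutes[of \<mu> lam] by blast
  define U :: "real^'n^'n" where "U = (\<chi> i. h (\<pi> i))"
  have row_U: "row i U = h (\<pi> i)" for i by (simp add: U_def row_def vec_eq_iff)
  have "orthogonal_matrix U"
    unfolding orthogonal_matrix_orthonormal_rows row_U
    using B(3,4) hB h_inj \<pi>(1) by (auto simp: pairwise_def bij_def inj_eq)
  then show ?thesis
    using that by (simp add: row_U \<mu> \<pi>(2))
qed

section \<open>Blocks and modal coordinates\<close>

text \<open>Bilinear expansion, with the symmetry of \<open>S\<close> merging the two mixed terms.
  The coefficients stay arbitrary because they are later the random links as well as the constant
  \<open>p\<close>.\<close>

lemma sum_quadratic_form_expand:
  fixes S :: "real^'a^'a"
  assumes "transpose S = S" and "finite J"
  shows "(c + (\<Sum>j\<in>J. a j *\<^sub>R v j)) \<bullet> (S *v (c + (\<Sum>j\<in>J. a j *\<^sub>R v j))) =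
    c \<bullet> (S *v c) + 2 * (\<Sum>j\<in>J. a j * (c \<bullet> (S *v v j)))
    + (\<Sum>j\<in>J. \<Sum>l\<in>J. a j * a l * (v j \<bullet> (S *v v l)))"
proof -
  define w where "w = (\<Sum>j\<in>J. a j *\<^sub>R v j)"
  have Sw: "S *v w = (\<Sum>j\<in>J. a j *\<^sub>R (S *v v j))"
    by (simp add: w_def linear_sum[OF matrix_vector_mul_linear] matrix_vector_mult_scaleR)
  have "w \<bullet> (S *v c) = c \<bullet> (S *v w)"
    using symmetric_matrix_inner[OF assms(1)] by (metis inner_commute)
  then have "(c + w) \<bullet> (S *v (c + w)) = c \<bullet> (S *v c) + 2 * (c \<bullet> (S *v w)) + w \<bullet> (S *v w)"
    by (simp add: matrix_vector_right_distrib inner_add)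
  also have "c \<bullet> (S *v w) = (\<Sum>j\<in>J. a j * (c \<bullet> (S *v v j)))"
    by (simp add: Sw inner_sum_right)
  also have "w \<bullet> (S *v w) = (\<Sum>j\<in>J. \<Sum>l\<in>J. a j * a l * (v j \<bullet> (S *v v l)))"
  proof -
    have "w \<bullet> z = (\<Sum>j\<in>J. a j * (v j \<bullet> z))" for z
      by (simp add: w_def inner_sum_left)
    from this[of "S *v w"] show ?thesis
      by (simp add: Sw inner_sum_right sum_distrib_left mult.assoc)
  qed
  finally show ?thesis unfolding w_def .
qed

definition block :: "real^('n::finite \<times> 'x::finite) \<Rightarrow> 'n \<Rightarrow> real^'x"
  where "block x i = (\<chi> a. x $ (i, a))"

lemma sum_UNIV_prod:
  fixes f :: "'a::finite \<times> 'b::finite \<Rightarrow> 'c::comm_monoid_add"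
  shows "(\<Sum>s\<in>UNIV. f s) = (\<Sum>i\<in>UNIV. \<Sum>a\<in>UNIV. f (i, a))"
  by (simp add: sum.cartesian_product flip: UNIV_Times_UNIV)

lemma inner_eq_sum_block:
  fixes x y :: "real^('n::finite \<times> 'x::finite)"
  shows "x \<bullet> y = (\<Sum>i\<in>UNIV. block x i \<bullet> block y i)"
  by (simp add: inner_vec_def block_def sum_UNIV_prod)

lemma block_kronecker:
  fixes A :: "real^'n^'n" and B :: "real^'b^'a"
  shows "block ((A \<otimes>\<^sub>K B) *v x) i = (\<Sum>j\<in>UNIV. A $ i $ j *\<^sub>R (B *v block x j))"
  by (simp add: vec_eq_iff block_def kronecker_def matrix_vector_mult_def sum_UNIV_prod
      sum_distrib_left mult.assoc)

text \<open>The diagonal entry supplies one copy of \<open>y i\<close> for each in-neighbour, and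
  without self-loops all in-neighbours sit off the diagonal; so only differences remain.\<close>

lemma sum_laplacian:
  fixes y :: "'n::finite \<Rightarrow> 'v::real_vector"
  assumes "irrefl E"
  shows "(\<Sum>j\<in>UNIV. laplacian E $ i $ j *\<^sub>R y j) = (\<Sum>j\<in>in_neighbours E i. y i - y j)"
proof -
  have i: "i \<notin> in_neighbours E i"
    using assms by (auto simp: irrefl_def in_neighbours_def)
  have "(\<Sum>j\<in>UNIV. laplacian E $ i $ j *\<^sub>R y j) =
      laplacian E $ i $ i *\<^sub>R y i + (\<Sum>j\<in>UNIV - {i}. laplacian E $ i $ j *\<^sub>R y j)"
    by (subst sum.remove[of _ i]) auto
  also have "(\<Sum>j\<in>UNIV - {i}. laplacian E $ i $ j *\<^sub>R y j) = (\<Sum>j\<in>in_neighbours E i. - y j)"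
    using i by (intro sum.mono_neutral_cong_right) (auto simp: laplacian_def)
  also have "laplacian E $ i $ i *\<^sub>R y i = (\<Sum>j\<in>in_neighbours E i. y i)"
    by (simp add: laplacian_def sum_constant_scaleR)
  finally show ?thesis by (simp add: sum_subtractf sum_negf)
qed

lemma block_decomposable:
  fixes Fd Fc :: "real^'b^'a" and x :: "real^('n::finite \<times> 'b)"
  assumes "irrefl E"
  shows "block (decomposable Fd Fc E *v x) i =
    Fd *v block x i + (\<Sum>j\<in>in_neighbours E i. Fc *v (block x i - block x j))"
proof -
  have "block (x + y) i = block x i + block y i" for x y :: "real^('n \<times> 'a)"
    by (simp add: block_def vec_eq_iff)
  moreover have "(\<Sum>j\<in>UNIV. mat 1 $ i $ j *\<^sub>R (Fd *v block x j)) = Fd *v block x i"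
    by (simp add: mat_def if_distrib [of "\<lambda>c. c *\<^sub>R _"] cong: if_cong)
  ultimately show ?thesis
    by (simp add: decomposable_def matrix_vector_mult_add_rdistrib block_kronecker
        sum_laplacian[OF assms] matrix_vector_mult_diff_distrib)
qed

section \<open>Modal coordinates and the Dirichlet form of the graph\<close>

lemma transpose_laplacian:
  assumes "sym E"
  shows "transpose (laplacian E) = laplacian E"
  using assms by (auto simp: transpose_def laplacian_def vec_eq_iff in_neighbours_def sym_def)

text \<open>Coordinates of a family of blocks with respect to the rows of \<open>U\<close>, that is,
  the blocks of \<open>U\<close> tensor identity applied to \<open>y\<close>. Families of blocks are
  used because blocks are transformed one by one before the change of basis.\<close>

definition modal :: "real^'n^'n \<Rightarrow> ('n \<Rightarrow> real^'x) \<Rightarrow> 'n \<Rightarrow> real^'x"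
  where "modal U y k = (\<Sum>i\<in>UNIV. U $ k $ i *\<^sub>R y i)"

lemma modal_add: "modal U (\<lambda>i. y i + z i) k = modal U y k + modal U z k"
  by (simp add: modal_def scaleR_add_right sum.distrib)

lemma modal_scaleR: "modal U (\<lambda>i. c *\<^sub>R y i) k = c *\<^sub>R modal U y k"
  by (simp add: modal_def scaleR_sum_right mult.commute)

lemma modal_matrix_vector_mult: "modal U (\<lambda>i. F *v y i) k = F *v modal U y k"
  by (simp add: modal_def linear_sum[OF matrix_vector_mul_linear] matrix_vector_mult_scaleR)

text \<open>Symmetry moves \<open>L\<close> from the blocks onto row \<open>k\<close> of
  \<open>U\<close>, where it acts as the scalar \<open>l\<close>.\<close>

lemma modal_eigenvector:
  fixes L U :: "real^'n^'n"
  assumes "transpose L = L" and "L *v row k U = l *\<^sub>R row k U"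
  shows "modal U (\<lambda>i. \<Sum>j\<in>UNIV. L $ i $ j *\<^sub>R y j) k = l *\<^sub>R modal U y k"
proof -
  have sym: "L $ i $ j = L $ j $ i" for i j
    using arg_cong[OF assms(1), of "\<lambda>A. A $ i $ j"] by (simp add: transpose_def)
  have "(\<Sum>i\<in>UNIV. U $ k $ i * L $ i $ j) = (L *v row k U) $ j" for j
    by (simp add: matrix_vector_mult_def row_def sym[of j] mult.commute)
  then have *: "(\<Sum>i\<in>UNIV. U $ k $ i * L $ i $ j) = l * U $ k $ j" for j
    unfolding assms(2) by (simp add: row_def)
  have "modal U (\<lambda>i. \<Sum>j\<in>UNIV. L $ i $ j *\<^sub>R y j) k =
      (\<Sum>i\<in>UNIV. \<Sum>j\<in>UNIV. (U $ k $ i * L $ i $ j) *\<^sub>R y j)"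
    by (simp add: modal_def scaleR_sum_right)
  also have "\<dots> = (\<Sum>j\<in>UNIV. (\<Sum>i\<in>UNIV. U $ k $ i * L $ i $ j) *\<^sub>R y j)"
    by (subst sum.swap) (simp add: scaleR_sum_left)
  also have "\<dots> = l *\<^sub>R modal U y k"
    by (simp add: * modal_def scaleR_sum_right)
  finally show ?thesis .
qed

text \<open>Parseval's identity, from the orthonormality of the columns of \<open>U\<close>.\<close>

lemma sum_inner_modal:
  fixes U :: "real^'n^'n"
  assumes "orthogonal_matrix U"
  shows "(\<Sum>k\<in>UNIV. modal U y k \<bullet> modal U z k) = (\<Sum>i\<in>UNIV. y i \<bullet> z i)"
proof -
  have "(transpose U ** U) $ i $ j = (mat 1 :: real^'n^'n) $ i $ j" for i j
    using assms by (simp add: orthogonal_matrix)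
  then have U: "(\<Sum>k\<in>UNIV. U $ k $ i * U $ k $ j) = (if i = j then 1 else 0)" for i j
    by (simp add: matrix_matrix_mult_def transpose_def mat_def)
  have "(\<Sum>k\<in>UNIV. modal U y k \<bullet> modal U z k) =
      (\<Sum>k\<in>UNIV. \<Sum>i\<in>UNIV. \<Sum>j\<in>UNIV. (U $ k $ i * U $ k $ j) * (y i \<bullet> z j))"
  proof -
    have "modal U y k \<bullet> v = (\<Sum>i\<in>UNIV. U $ k $ i * (y i \<bullet> v))" for k v
      by (simp add: modal_def inner_sum_left)
    from this[of _ "modal U z _"] show ?thesis
      by (simp add: modal_def[of U z] inner_sum_right sum_distrib_left mult.assoc)
  qed
  also have "\<dots> = (\<Sum>i\<in>UNIV. \<Sum>j\<in>UNIV. \<Sum>k\<in>UNIV. (U $ k $ i * U $ k $ j) * (y i \<bullet> z j))"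
    by (subst sum.swap, rule sum.cong[OF refl], subst sum.swap, rule refl)
  also have "\<dots> = (\<Sum>i\<in>UNIV. \<Sum>j\<in>UNIV. (if i = j then 1 else 0) * (y i \<bullet> z j))"
    by (simp add: sum_distrib_right[symmetric] U del: mult_eq_0_iff)
  also have "\<dots> = (\<Sum>i\<in>UNIV. y i \<bullet> z i)"
    by (simp add: if_distrib [of "\<lambda>c. c * _"] cong: if_cong)
  finally show ?thesis .
qed

lemma sum_quadratic_form_modal:
  fixes U :: "real^'n^'n"
  assumes "orthogonal_matrix U"
  shows "(\<Sum>k\<in>UNIV. modal U y k \<bullet> (S *v modal U z k)) = (\<Sum>i\<in>UNIV. y i \<bullet> (S *v z i))"
  using sum_inner_modal[OF assms, of y "\<lambda>i. S *v z i"] by (simp add: modal_matrix_vector_mult)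

text \<open>The form of a difference splits into one term for each endpoint. In an undirected graph
  the exchange of endpoints maps the edge set to itself, so the two sums agree; this is the source
  of the factor 2.\<close>

lemma dirichlet_form_laplacian:
  fixes S :: "real^'a^'a" and y :: "'n::finite \<Rightarrow> real^'a"
  assumes "irrefl E" and "sym E"
  shows "(\<Sum>i\<in>UNIV. \<Sum>j\<in>in_neighbours E i. (y i - y j) \<bullet> (S *v (y i - y j))) =
    2 * (\<Sum>i\<in>UNIV. y i \<bullet> (S *v (\<Sum>j\<in>UNIV. laplacian E $ i $ j *\<^sub>R y j)))"
proof -
  let ?f = "\<lambda>i j. y i \<bullet> (S *v (y i - y j))"
  have swap: "(\<Sum>i\<in>UNIV. \<Sum>j\<in>in_neighbours E i. h i j) = (\<Sum>i\<in>UNIV. \<Sum>j\<in>in_neighbours E i. h j i)"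
    for h :: "'n \<Rightarrow> 'n \<Rightarrow> real"
  proof -
    have "(\<Sum>i\<in>UNIV. \<Sum>j\<in>in_neighbours E i. h i j) =
        (\<Sum>i\<in>UNIV. \<Sum>j\<in>UNIV. if (j, i) \<in> E then h i j else 0)" for h :: "'n \<Rightarrow> 'n \<Rightarrow> real"
      by (simp add: in_neighbours_def flip: sum.inter_filter)
    note * = this
    show ?thesis
      unfolding * by (subst sum.swap) (use assms(2) in \<open>intro sum.cong refl, auto simp: sym_def\<close>)
  qed
  have "(y i - y j) \<bullet> (S *v (y i - y j)) = ?f i j + ?f j i" for i j
    by (simp add: matrix_vector_mult_diff_distrib inner_diff)
  then have "(\<Sum>i\<in>UNIV. \<Sum>j\<in>in_neighbours E i. (y i - y j) \<bullet> (S *v (y i - y j))) =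
      2 * (\<Sum>i\<in>UNIV. \<Sum>j\<in>in_neighbours E i. ?f i j)"
    using swap[of "\<lambda>i j. ?f i j"] by (simp add: sum.distrib)
  also have "(\<Sum>i\<in>UNIV. \<Sum>j\<in>in_neighbours E i. ?f i j) =
      (\<Sum>i\<in>UNIV. y i \<bullet> (S *v (\<Sum>j\<in>UNIV. laplacian E $ i $ j *\<^sub>R y j)))"
    by (simp add: sum_laplacian[OF assms(1)] linear_sum[OF matrix_vector_mul_linear] inner_sum_right)
  finally show ?thesis .
qed

section \<open>Expected quadratic forms under packet loss\<close>

lemma (in prob_space) integrable_finite_valued:
  fixes f :: "'m::finite \<Rightarrow> real"
  assumes [measurable]: "X \<in> measurable M (count_space UNIV)"
  shows "integrable M (\<lambda>\<omega>. f (X \<omega>))"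
proof (rule integrable_const_bound)
  show "AE \<omega> in M. norm (f (X \<omega>)) \<le> (\<Sum>m\<in>UNIV. \<bar>f m\<bar>)"
    by (auto intro!: member_le_sum)
qed measurable

lemma (in prob_space) expectation_finite_valued:
  fixes f :: "'m::finite \<Rightarrow> real"
  assumes [measurable]: "X \<in> measurable M (count_space UNIV)"
  shows "expectation (\<lambda>\<omega>. f (X \<omega>)) = (\<Sum>m\<in>UNIV. prob {\<omega> \<in> space M. X \<omega> = m} * f m)"
proof -
  have "expectation (\<lambda>\<omega>. f (X \<omega>)) =
      expectation (\<lambda>\<omega>. \<Sum>m\<in>UNIV. indicator {\<omega> \<in> space M. X \<omega> = m} \<omega> * f m)"
    by (intro Bochner_Integration.integral_cong refl) (simp add: indicator_def)
  also have "\<dots> = (\<Sum>m\<in>UNIV. expectation (\<lambda>\<omega>. indicator {\<omega> \<in> space M. X \<omega> = m} \<omega> * f m))"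
    by (intro Bochner_Integration.integral_sum integrable_mult_left integrable_real_indicator)
      (auto simp: less_top[symmetric])
  also have "\<dots> = (\<Sum>m\<in>UNIV. prob {\<omega> \<in> space M. X \<omega> = m} * f m)"
    by simp
  finally show ?thesis .
qed

context bernoulli_packet_loss
begin

lemma active_edges_measurable [measurable]:
  "active_edges E \<alpha> k \<in> measurable M (count_space UNIV)"
  using indep_time by (simp add: indep_vars_def)

text \<open>The indices follow the Laplacian: \<open>link k i j\<close> belongs to the edge from
  \<open>j\<close> to \<open>i\<close>, that is, to entry \<open>(i, j)\<close>. It vanishes for
  pairs outside \<open>E\<close>.\<close>

definition link :: "nat \<Rightarrow> 'n \<Rightarrow> 'n \<Rightarrow> 'a \<Rightarrow> real"
  where "link k i j \<omega> = of_bool ((j, i) \<in> active_edges E \<alpha> k \<omega>)"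

lemma integrable_link: "integrable M (link k i j)"
  and integrable_link_mult: "integrable M (\<lambda>\<omega>. link k i j \<omega> * link k i l \<omega>)"
  unfolding link_def [abs_def]
  using integrable_finite_valued[OF active_edges_measurable, of "\<lambda>A. of_bool ((j, i) \<in> A)"]
    integrable_finite_valued[OF active_edges_measurable,
      of "\<lambda>A. of_bool ((j, i) \<in> A) * of_bool ((l, i) \<in> A)"]
  by auto

lemma expectation_link:
  assumes "(j, i) \<in> E"
  shows "expectation (link k i j) = p"
proof -
  have [measurable]: "\<alpha> (j, i) k \<in> measurable M (count_space UNIV)"
    using random[OF assms] .
  have "expectation (link k i j) = expectation (indicator {\<omega> \<in> space M. \<alpha> (j, i) k \<omega>})"
    using assms
    by (intro Bochner_Integration.integral_cong refl) (simp add: link_def active_edges_def indicator_def)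
  then show ?thesis
    using transmission[OF assms] by simp
qed

text \<open>A 0/1 variable equals its square, which settles \<open>j = l\<close>; two distinct links
  with the same head are independent.\<close>

lemma expectation_link_mult:
  assumes "irrefl E" "(j, i) \<in> E" "(l, i) \<in> E"
  shows "expectation (\<lambda>\<omega>. link k i j \<omega> * link k i l \<omega>) = (if j = l then p else p\<^sup>2)"
proof (cases "j = l")
  case True
  then have "(\<lambda>\<omega>. link k i j \<omega> * link k i l \<omega>) = link k i j"
    by (auto simp: link_def fun_eq_iff)
  with True show ?thesis using expectation_link[OF assms(2)] by simp
next
  case False
  \<comment> \<open>If \<open>(l, i)\<close> were the reverse of \<open>(j, i)\<close>, then
    \<open>l = i\<close> and the edge would be a self-loop; so the assumption on non-opposing links
    applies.\<close>
  have "i \<noteq> l" using assms(1,3) by (auto simp: irrefl_def)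
  have "indep_var (count_space UNIV) (\<alpha> (j, i) k) (count_space UNIV) (\<alpha> (l, i) k)"
    using assms False \<open>i \<noteq> l\<close> by (intro indep_links) auto
  then have "indep_var borel (of_bool \<circ> \<alpha> (j, i) k) borel (of_bool \<circ> \<alpha> (l, i) k :: _ \<Rightarrow> real)"
    by (rule indep_var_compose) auto
  moreover have "of_bool \<circ> \<alpha> (j, i) k = link k i j" "of_bool \<circ> \<alpha> (l, i) k = link k i l"
    using assms by (auto simp: link_def active_edges_def)
  ultimately have "indep_var borel (link k i j) borel (link k i l)" by simp
  from indep_var_lebesgue_integral[OF this] show ?thesis
    using False assms by (simp add: integrable_link expectation_link power2_eq_square)
qed

text \<open>The cross terms of the quadratic form only involve links with a common head; no two of these
  are opposing, so the variance is the sum of the variances of the single links.\<close>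

lemma expectation_quadratic_form_links:
  fixes S :: "real^'y^'y" and c :: "real^'y" and i :: 'n
  assumes "irrefl E" "transpose S = S"
  defines "N \<equiv> in_neighbours E i"
  shows "expectation (\<lambda>\<omega>. (c + (\<Sum>j\<in>N. link k i j \<omega> *\<^sub>R v j)) \<bullet> (S *v (c + (\<Sum>j\<in>N. link k i j \<omega> *\<^sub>R v j))))
    = (c + p *\<^sub>R (\<Sum>j\<in>N. v j)) \<bullet> (S *v (c + p *\<^sub>R (\<Sum>j\<in>N. v j)))
      + p * (1 - p) * (\<Sum>j\<in>N. v j \<bullet> (S *v v j))"
proof -
  let ?b = "\<lambda>j l. v j \<bullet> (S *v v l)"
  have E: "(j, i) \<in> E" if "j \<in> N" for j
    using that by (simp add: N_def in_neighbours_def)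
  have "expectation (\<lambda>\<omega>. (c + (\<Sum>j\<in>N. link k i j \<omega> *\<^sub>R v j)) \<bullet> (S *v (c + (\<Sum>j\<in>N. link k i j \<omega> *\<^sub>R v j))))
    = expectation (\<lambda>\<omega>. c \<bullet> (S *v c) + 2 * (\<Sum>j\<in>N. link k i j \<omega> * (c \<bullet> (S *v v j)))
      + (\<Sum>j\<in>N. \<Sum>l\<in>N. link k i j \<omega> * link k i l \<omega> * ?b j l))"
    by (simp add: sum_quadratic_form_expand[OF assms(2)])
  also have "\<dots> = c \<bullet> (S *v c) + 2 * (\<Sum>j\<in>N. expectation (link k i j) * (c \<bullet> (S *v v j)))
      + (\<Sum>j\<in>N. \<Sum>l\<in>N. expectation (\<lambda>\<omega>. link k i j \<omega> * link k i l \<omega>) * ?b j l)"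
    by (simp add: Bochner_Integration.integral_sum integrable_link integrable_link_mult prob_space)
  also have "(\<Sum>j\<in>N. expectation (link k i j) * (c \<bullet> (S *v v j))) = (\<Sum>j\<in>N. p * (c \<bullet> (S *v v j)))"
    by (intro sum.cong refl) (simp add: expectation_link E)
  \<comment> \<open>For \<open>j = l\<close> the value \<open>p\<close> is split as
    \<open>p * p + p * (1 - p)\<close>: the first part completes the square of the mean, the second
    is the variance of one link.\<close>
  also have "(\<Sum>j\<in>N. \<Sum>l\<in>N. expectation (\<lambda>\<omega>. link k i j \<omega> * link k i l \<omega>) * ?b j l)
      = (\<Sum>j\<in>N. \<Sum>l\<in>N. p * p * ?b j l + (if j = l then p * (1 - p) * ?b j l else 0))"
    by (intro sum.cong refl)
      (simp add: expectation_link_mult assms(1) E power2_eq_square algebra_simps)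
  also have "\<dots> = (\<Sum>j\<in>N. \<Sum>l\<in>N. p * p * ?b j l) + p * (1 - p) * (\<Sum>j\<in>N. ?b j j)"
    by (simp add: sum.distrib sum_distrib_left)
  also have "c \<bullet> (S *v c) + 2 * (\<Sum>j\<in>N. p * (c \<bullet> (S *v v j)))
      + ((\<Sum>j\<in>N. \<Sum>l\<in>N. p * p * ?b j l) + p * (1 - p) * (\<Sum>j\<in>N. ?b j j))
    = (c + p *\<^sub>R (\<Sum>j\<in>N. v j)) \<bullet> (S *v (c + p *\<^sub>R (\<Sum>j\<in>N. v j))) + p * (1 - p) * (\<Sum>j\<in>N. ?b j j)"
    using sum_quadratic_form_expand[OF assms(2), of N c "\<lambda>_. p" v]
    by (simp add: scaleR_sum_right)
  finally show ?thesis .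
qed

text \<open>A lost packet only deletes a summand. Weighting by \<open>link\<close> keeps the index
  set fixed, so that the randomness enters linearly through the coefficients.\<close>

lemma block_decomposable_active_edges:
  fixes Fd Fc :: "real^'b^'y"
  assumes "irrefl E"
  shows "block (decomposable Fd Fc (active_edges E \<alpha> k \<omega>) *v x) i =
    Fd *v block x i + (\<Sum>j\<in>in_neighbours E i. link k i j \<omega> *\<^sub>R (Fc *v (block x i - block x j)))"
proof -
  have "irrefl (active_edges E \<alpha> k \<omega>)"
    using assms by (auto simp: irrefl_def active_edges_def)
  moreover have "(\<Sum>j\<in>in_neighbours (active_edges E \<alpha> k \<omega>) i. Fc *v (block x i - block x j)) =
      (\<Sum>j\<in>in_neighbours E i. link k i j \<omega> *\<^sub>R (Fc *v (block x i - block x j)))"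
    by (intro sum.mono_neutral_cong_left)
      (auto simp: in_neighbours_def active_edges_def link_def)
  ultimately show ?thesis by (simp add: block_decomposable)
qed

text \<open>In each block the expectation is the form at the mean plus the link variances. Summed
  over the blocks, the variances become a Laplacian form; modal coordinates diagonalise this form
  and the mean dynamics simultaneously.\<close>

lemma expectation_quadratic_form_decomposable:
  fixes Fd Fc :: "real^'b^'y" and x :: "real^('n \<times> 'b)" and S :: "real^'y^'y" and U :: "real^'n^'n"
  assumes "irrefl E" "sym E" and S: "transpose S = S"
    and U: "orthogonal_matrix U" "\<And>m. laplacian E *v row m U = lam m *\<^sub>R row m U"
  defines "y \<equiv> modal U (block x)"
  shows "expectation (\<lambda>\<omega>. \<Sum>i\<in>UNIV. block (decomposable Fd Fc (active_edges E \<alpha> k \<omega>) *v x) i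
      \<bullet> (S *v block (decomposable Fd Fc (active_edges E \<alpha> k \<omega>) *v x) i)) =
    (\<Sum>m\<in>UNIV. ((Fd + (p * lam m) *\<^sub>R Fc) *v y m) \<bullet> (S *v ((Fd + (p * lam m) *\<^sub>R Fc) *v y m))
      + 2 * p * (1 - p) * lam m * ((Fc *v y m) \<bullet> (S *v (Fc *v y m))))"
    (is "?L = _")
proof -
  let ?F = "\<lambda>\<omega>. decomposable Fd Fc (active_edges E \<alpha> k \<omega>)"
  let ?N = "in_neighbours E"
  define u where "u i = Fc *v block x i" for i
  \<comment> \<open>\<open>c i\<close> is the mean of block \<open>i\<close> after one step: the
    links are replaced by their expectation \<open>p\<close>.\<close>
  define c where "c i = Fd *v block x i + p *\<^sub>R (\<Sum>j\<in>UNIV. laplacian E $ i $ j *\<^sub>R u j)" for i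
  have sumN: "(\<Sum>j\<in>?N i. Fc *v (block x i - block x j)) = (\<Sum>j\<in>UNIV. laplacian E $ i $ j *\<^sub>R u j)" for i
    by (simp add: sum_laplacian[OF assms(1)] u_def matrix_vector_mult_diff_distrib)
  have modal_u: "modal U u m = Fc *v y m" for m
    unfolding u_def [abs_def] y_def by (rule modal_matrix_vector_mult)
  have modal_c: "modal U c m = (Fd + (p * lam m) *\<^sub>R Fc) *v y m" for m
  proof -
    have "modal U c m = Fd *v y m + p *\<^sub>R (lam m *\<^sub>R (Fc *v y m))"
      unfolding c_def [abs_def] modal_add modal_scaleR modal_matrix_vector_mult
        modal_eigenvector[OF transpose_laplacian[OF assms(2)] U(2)]
        modal_u y_def ..
    then show ?thesis
      by (simp add: matrix_vector_mult_add_rdistrib scaleR_matrix_vector_assoc)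
  qed
  have "?L = (\<Sum>i\<in>UNIV. expectation (\<lambda>\<omega>. block (?F \<omega> *v x) i \<bullet> (S *v block (?F \<omega> *v x) i)))"
    by (intro Bochner_Integration.integral_sum
        integrable_finite_valued[OF active_edges_measurable,
          where f="\<lambda>A. block (decomposable Fd Fc A *v x) _ \<bullet> (S *v block (decomposable Fd Fc A *v x) _)"])
  also have "\<dots> = (\<Sum>i\<in>UNIV. c i \<bullet> (S *v c i) + p * (1 - p) * (\<Sum>j\<in>?N i. (u i - u j) \<bullet> (S *v (u i - u j))))"
    unfolding block_decomposable_active_edges[OF assms(1)]
      expectation_quadratic_form_links[OF assms(1) S] sumN
    by (simp add: c_def u_def matrix_vector_mult_diff_distrib)
  also have "\<dots> = (\<Sum>i\<in>UNIV. c i \<bullet> (S *v c i)) +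
      p * (1 - p) * (2 * (\<Sum>i\<in>UNIV. u i \<bullet> (S *v (\<Sum>j\<in>UNIV. laplacian E $ i $ j *\<^sub>R u j))))"
    unfolding dirichlet_form_laplacian[OF assms(1,2), symmetric]
    by (simp add: sum.distrib sum_distrib_left)
  also have "\<dots> = (\<Sum>m\<in>UNIV. modal U c m \<bullet> (S *v modal U c m)) +
      p * (1 - p) * (2 * (\<Sum>m\<in>UNIV. modal U u m \<bullet> (S *v (lam m *\<^sub>R modal U u m))))"
    using sum_quadratic_form_modal[OF U(1), of c S c]
      sum_quadratic_form_modal[OF U(1), of u S "\<lambda>i. \<Sum>j\<in>UNIV. laplacian E $ i $ j *\<^sub>R u j"]
    unfolding modal_eigenvector[OF transpose_laplacian[OF assms(2)] U(2)] by simp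
  finally show ?thesis
    by (simp add: modal_u modal_c sum.distrib sum_distrib_left matrix_vector_mult_scaleR
        mult.assoc mult.left_commute[of 2] del: right_diff_distrib_numeral)
qed

end

section \<open>Dissipative jump systems\<close>

text \<open>A history of finite length takes finitely many values, so it is measurable into a
  discrete space, and every function of the history is then measurable too.\<close>

lemma (in prob_space) restrict_measurable_count_space:
  fixes \<sigma> :: "nat \<Rightarrow> 'a \<Rightarrow> 'm::finite"
  assumes "\<And>l. \<sigma> l \<in> measurable M (count_space UNIV)"
  shows "(\<lambda>\<omega>. restrict (\<lambda>l. \<sigma> l \<omega>) {..<k}) \<in>
    measurable M (count_space (PiE {..<k} (\<lambda>_. UNIV)))"
proof -
  have "(\<lambda>\<omega>. restrict (\<lambda>l. \<sigma> l \<omega>) {..<k}) \<in> measurable M (PiM {..<k} (\<lambda>_. count_space UNIV))"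
    using assms by (intro measurable_restrict) auto
  also have "PiM {..<k} (\<lambda>_. count_space (UNIV :: 'm set)) = count_space (PiE {..<k} (\<lambda>_. UNIV))"
    by (intro count_space_PiM_finite) (auto intro: countable_finite)
  finally show ?thesis .
qed

text \<open>\<open>X\<close> is determined by the modes before time \<open>k\<close>, hence
  independent of the mode at time \<open>k\<close>. The joint law is therefore a product, and Fubini
  lets a separate sample point \<open>\<omega>'\<close> drive the current mode.\<close>

lemma (in prob_space) nn_integral_past_independent:
  fixes \<sigma> :: "nat \<Rightarrow> 'a \<Rightarrow> 'm::finite" and g :: "'b \<Rightarrow> 'm \<Rightarrow> ennreal"
  assumes ind: "indep_vars (\<lambda>_. count_space UNIV) \<sigma> UNIV"
    and X: "\<And>\<omega>. X \<omega> = F (restrict (\<lambda>l. \<sigma> l \<omega>) {..<k})"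
  shows "(\<integral>\<^sup>+\<omega>. g (X \<omega>) (\<sigma> k \<omega>) \<partial>M) = (\<integral>\<^sup>+\<omega>. (\<integral>\<^sup>+\<omega>'. g (X \<omega>) (\<sigma> k \<omega>') \<partial>M) \<partial>M)"
proof -
  define P where "P J = (PiE J (\<lambda>_. UNIV) :: (nat \<Rightarrow> 'm) set)" for J
  define R where "R J \<omega> = restrict (\<lambda>l. \<sigma> l \<omega>) J" for J \<omega>
  let ?N = "count_space (P {..<k})" and ?K = "count_space (P {k})"
  have PiM: "PiM J (\<lambda>_. count_space (UNIV :: 'm set)) = count_space (P J)" if "finite J" for J
    unfolding P_def using that by (intro count_space_PiM_finite) (auto intro: countable_finite)
  have "countable (P {..<k})"
    unfolding P_def by (intro countable_finite finite_PiE) auto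
  have "indep_var ?N (R {..<k}) ?K (R {k})"
    using indep_var_restrict[OF ind, of "{..<k}" "{k}"] by (simp add: PiM R_def [abs_def])
  then have R [measurable]: "R {..<k} \<in> measurable M ?N" "R {k} \<in> measurable M ?K"
    and distr: "distr M ?N (R {..<k}) \<Otimes>\<^sub>M distr M ?K (R {k}) =
      distr M (?N \<Otimes>\<^sub>M ?K) (\<lambda>\<omega>. (R {..<k} \<omega>, R {k} \<omega>))"
    by (simp_all add: indep_var_distribution_eq)
  \<comment> \<open>The mode at time \<open>k\<close> appears here as a function on the singleton
    \<open>{k}\<close>, hence the evaluation \<open>f k\<close>.\<close>
  define h where "h = (\<lambda>(q, f). g (F q) (f k))"
  have h [measurable]: "h \<in> borel_measurable (?N \<Otimes>\<^sub>M ?K)"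
    using \<open>countable (P {..<k})\<close> by (intro measurable_pair_measure_countable1) auto
  have h_R: "h (R {..<k} \<omega>, R {k} \<omega>') = g (X \<omega>) (\<sigma> k \<omega>')" for \<omega> \<omega>'
    by (simp add: h_def X R_def)
  interpret R: prob_space "distr M ?K (R {k})"
    by (intro prob_space_distr) measurable
  have "(\<integral>\<^sup>+\<omega>. h (R {..<k} \<omega>, R {k} \<omega>) \<partial>M) =
      (\<integral>\<^sup>+y. h y \<partial>distr M (?N \<Otimes>\<^sub>M ?K) (\<lambda>\<omega>. (R {..<k} \<omega>, R {k} \<omega>)))"
    by (subst nn_integral_distr) measurable
  also have "\<dots> = (\<integral>\<^sup>+q. (\<integral>\<^sup>+f. h (q, f) \<partial>distr M ?K (R {k})) \<partial>distr M ?N (R {..<k}))"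
    unfolding distr[symmetric]
    by (rule R.nn_integral_fst[symmetric]) simp
  also have "\<dots> = (\<integral>\<^sup>+\<omega>. (\<integral>\<^sup>+f. h (R {..<k} \<omega>, f) \<partial>distr M ?K (R {k})) \<partial>M)"
    by (rule nn_integral_distr[OF R(1)]) simp
  also have "\<dots> = (\<integral>\<^sup>+\<omega>. (\<integral>\<^sup>+\<omega>'. h (R {..<k} \<omega>, R {k} \<omega>') \<partial>M) \<partial>M)"
    by (subst nn_integral_distr[OF R(2)]) simp_all
  finally show ?thesis by (simp add: h_R)
qed

section \<open>Stored energy and output energy along a jump system\<close>

lemma jump_state_cong:
  "(\<And>l. l < k \<Longrightarrow> s l = s' l) \<Longrightarrow> jump_state A B s w x0 k = jump_state A B s' w x0 k"
  by (induction k) auto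

text \<open>The state at time \<open>k\<close> only sees modes strictly before \<open>k\<close>;
  this form exhibits it as a function of the history, as \<open>nn_integral_past_independent\<close>
  requires.\<close>

lemma jump_state_restrict:
  "jump_state A B (s(0 := i)) w x0 k = jump_state A B ((restrict s {..<k})(0 := i)) w x0 k"
  by (intro jump_state_cong) auto

lemma (in prob_space) jump_state_measurable:
  fixes \<sigma> :: "nat \<Rightarrow> 'a \<Rightarrow> 'm::finite"
  assumes "\<And>l. \<sigma> l \<in> measurable M (count_space UNIV)"
  shows "(\<lambda>\<omega>. jump_state A B ((\<lambda>l. \<sigma> l \<omega>)(0 := i)) w x0 k) \<in> measurable M (count_space UNIV)"
  unfolding jump_state_restrict[of _ _ "\<lambda>l. \<sigma> l _"]
  by (rule measurable_compose[OF restrict_measurable_count_space[OF assms]]) auto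

text \<open>The prescribed initial mode and the initial input only enter the state at time 1; from then on
  \<open>V\<close> is a Lyapunov function whose expected decrease pays for the output energy.\<close>

locale dissipative_jump_system = prob_space M for M :: "'a measure" +
  fixes \<sigma> :: "nat \<Rightarrow> 'a \<Rightarrow> 'm::finite"
    and A :: "'m \<Rightarrow> real^'x^'x" and B :: "'m \<Rightarrow> real^'w^'x"
    and C :: "'m \<Rightarrow> real^'x^'z" and D :: "'m \<Rightarrow> real^'w^'z"
    and V :: "real^'x \<Rightarrow> real" and r :: real
  assumes indep: "indep_vars (\<lambda>_. count_space UNIV) \<sigma> UNIV"
    and V_nonneg: "0 \<le> V x"
    and r: "0 \<le> r" "r \<le> 1"
    and dissipation: "(\<integral>\<^sup>+\<omega>. ennreal (V (A (\<sigma> k \<omega>) *v x)) +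
      ennreal ((C (\<sigma> k \<omega>) *v x) \<bullet> (C (\<sigma> k \<omega>) *v x)) \<partial>M) \<le> ennreal (r * V x)"
begin

lemma mode_measurable [measurable]: "\<sigma> k \<in> measurable M (count_space UNIV)"
  using indep by (simp add: indep_vars_def)

context
  fixes w :: "nat \<Rightarrow> real^'w" and x0 :: "real^'x" and i :: 'm
  assumes no_input: "k \<ge> 1 \<Longrightarrow> w k = 0"
begin

abbreviation "state k \<omega> \<equiv> jump_state A B ((\<lambda>l. \<sigma> l \<omega>)(0 := i)) w x0 k"
abbreviation "energy k \<equiv> (\<integral>\<^sup>+\<omega>. ennreal (V (state k \<omega>)) \<partial>M)"
abbreviation "supply k \<equiv>
  (\<integral>\<^sup>+\<omega>. ennreal ((C (\<sigma> k \<omega>) *v state k \<omega>) \<bullet> (C (\<sigma> k \<omega>) *v state k \<omega>)) \<partial>M)"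

lemma state_measurable: "state k \<in> measurable M (count_space UNIV)"
  by (rule jump_state_measurable) (rule mode_measurable)

lemma state_measurable_mode:
  fixes f :: "'m \<Rightarrow> real^'x \<Rightarrow> 'b::topological_space"
  shows "(\<lambda>\<omega>. f (\<sigma> k \<omega>) (state k \<omega>)) \<in> borel_measurable M"
  by (rule measurable_compose_countable[where f="\<lambda>m \<omega>. f m (state k \<omega>)", OF _ mode_measurable])
    (rule measurable_compose[OF state_measurable], simp)

text \<open>From time 1 on the input vanishes and the mode is the random one, independent of the
  current state, so \<open>dissipation\<close> can be applied with the state held fixed. At time 0
  the mode is prescribed.\<close>

lemma energy_step:
  assumes "k \<ge> 1"
  shows "energy (Suc k) + supply k \<le> ennreal r * energy k"
proof -
  have "energy (Suc k) + supply k = (\<integral>\<^sup>+\<omega>. ennreal (V (A (\<sigma> k \<omega>) *v state k \<omega>)) +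
      ennreal ((C (\<sigma> k \<omega>) *v state k \<omega>) \<bullet> (C (\<sigma> k \<omega>) *v state k \<omega>)) \<partial>M)"
    using assms no_input[OF assms]
    by (subst nn_integral_add) (simp_all add: state_measurable_mode
        state_measurable_mode[where f="\<lambda>m x. ennreal (V (A m *v x))"]
        state_measurable_mode[where f="\<lambda>m x. ennreal ((C m *v x) \<bullet> (C m *v x))"])
  also have "\<dots> = (\<integral>\<^sup>+\<omega>. (\<integral>\<^sup>+\<omega>'. ennreal (V (A (\<sigma> k \<omega>') *v state k \<omega>)) +
      ennreal ((C (\<sigma> k \<omega>') *v state k \<omega>) \<bullet> (C (\<sigma> k \<omega>') *v state k \<omega>)) \<partial>M) \<partial>M)"
    by (rule nn_integral_past_independent[OF indep,
          where g="\<lambda>x m. ennreal (V (A m *v x)) + ennreal ((C m *v x) \<bullet> (C m *v x))"])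
      (rule jump_state_restrict)
  also have "\<dots> \<le> (\<integral>\<^sup>+\<omega>. ennreal r * ennreal (V (state k \<omega>)) \<partial>M)"
    using dissipation by (intro nn_integral_mono) (simp add: ennreal_mult r V_nonneg)
  also have "\<dots> = ennreal r * energy k"
    by (intro nn_integral_cmult state_measurable_mode[where f="\<lambda>m x. ennreal (V x)"])
  finally show ?thesis .
qed

text \<open>The state at time 1 is deterministic, and contraction starts there; hence the exponent
  \<open>k\<close> at time \<open>Suc k\<close>.\<close>

lemma energy_decay: "energy (Suc k) \<le> ennreal (r ^ k * V (A i *v x0 + B i *v w 0))"
proof (induction k)
  case 0
  then show ?case by (simp add: emeasure_space_1)
next
  case (Suc k)
  have "energy (Suc (Suc k)) \<le> energy (Suc (Suc k)) + supply (Suc k)" by simp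
  also have "\<dots> \<le> ennreal r * energy (Suc k)" by (rule energy_step) simp
  also have "\<dots> \<le> ennreal r * ennreal (r ^ k * V (A i *v x0 + B i *v w 0))"
    using Suc by (rule mult_left_mono) simp
  also have "\<dots> = ennreal (r ^ Suc k * V (A i *v x0 + B i *v w 0))"
    using r V_nonneg by (simp add: ennreal_mult[symmetric] mult.assoc)
  finally show ?case .
qed

lemma output_energy_le:
  "output_energy M (\<lambda>k \<omega>. jump_output A B C D ((\<lambda>l. \<sigma> l \<omega>)(0 := i)) w x0 k)
    \<le> ennreal (V (A i *v x0 + B i *v w 0) +
        (C i *v x0 + D i *v w 0) \<bullet> (C i *v x0 + D i *v w 0))" (is "output_energy M ?z \<le> ennreal (?v + ?o)")
proof -
  define e where "e k = (\<integral>\<^sup>+\<omega>. ennreal (?z k \<omega> \<bullet> ?z k \<omega>) \<partial>M)" for k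
  have e0: "e 0 = ennreal ?o"
    by (simp add: e_def jump_output_def emeasure_space_1)
  have eS: "e (Suc k) = supply (Suc k)" for k
    by (simp add: e_def jump_output_def no_input del: jump_state.simps)
  \<comment> \<open>The remaining stored energy is carried through the induction and dropped
    afterwards. As \<open>r \<le> 1\<close>, each output term is covered by the drop in stored
    energy.\<close>
  have "(\<Sum>k<Suc n. e k) + energy (Suc n) \<le> ennreal (?v + ?o)" for n
  proof (induction n)
    case 0
    then show ?case
      using V_nonneg by (simp add: e0 emeasure_space_1 ennreal_plus add.commute)
  next
    case (Suc n)
    have "energy (Suc (Suc n)) + e (Suc n) \<le> ennreal r * energy (Suc n)"
      unfolding eS by (rule energy_step) simp
    also have "\<dots> \<le> 1 * energy (Suc n)"
      using r by (intro mult_right_mono) auto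
    finally have "energy (Suc (Suc n)) + e (Suc n) \<le> energy (Suc n)" by simp
    then have "(\<Sum>k<Suc n. e k) + (energy (Suc (Suc n)) + e (Suc n)) \<le> (\<Sum>k<Suc n. e k) + energy (Suc n)"
      by (rule add_left_mono)
    also note Suc
    finally show ?case
      by (simp only: sum.lessThan_Suc[of _ "Suc n"] ac_simps)
  qed
  then have "(\<Sum>k<Suc n. e k) \<le> ennreal (?v + ?o)" for n
    by (meson order_trans le_add1 add_increasing2 zero_le order_refl)
  then have "(\<Sum>k<n. e k) \<le> ennreal (?v + ?o)" for n
    by (cases n) (simp_all del: sum.lessThan_Suc)
  then show ?thesis
    unfolding output_energy_def e_def [symmetric] by (intro suminf_le_const summableI)
qed

end

end

text \<open>Row \<open>i\<close> of the matrix is \<open>v $ i\<close> times \<open>v\<close>, so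
  the Frobenius norm factors. Both limits in mean-square stability thus reduce to the second
  moment.\<close>

lemma norm_outer: "norm (outer v) = (norm v)\<^sup>2"
proof -
  have "norm (outer v $ i) = norm v * \<bar>v $ i\<bar>" for i
  proof -
    have "outer v $ i = v $ i *\<^sub>R v" by (simp add: outer_def vec_eq_iff)
    then show ?thesis by simp
  qed
  then have "norm (outer v) = L2_set (\<lambda>i. norm v * \<bar>v $ i\<bar>) UNIV"
    by (simp add: norm_vec_def[of "outer v"])
  also have "\<dots> = norm v * norm v"
    by (simp add: L2_set_right_distrib[symmetric] norm_vec_def)
  finally show ?thesis by (simp add: power2_eq_square)
qed

lemma (in prob_space) second_moment_tendsto_zero:
  fixes X :: "nat \<Rightarrow> 'a \<Rightarrow> real^'x"
  assumes X [measurable]: "\<And>k. X k \<in> borel_measurable M"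
    and le: "\<And>k. (\<integral>\<^sup>+\<omega>. ennreal ((norm (X k \<omega>))\<^sup>2) \<partial>M) \<le> ennreal (a k)"
    and a: "\<And>k. 0 \<le> a k" "a \<longlonglongrightarrow> 0"
  shows "(\<lambda>k. expectation (\<lambda>\<omega>. norm (X k \<omega>))) \<longlonglongrightarrow> 0"
    and "(\<lambda>k. expectation (\<lambda>\<omega>. norm (outer (X k \<omega>)))) \<longlonglongrightarrow> 0"
proof -
  have int2: "integrable M (\<lambda>\<omega>. (norm (X k \<omega>))\<^sup>2)" for k
    using le_less_trans[OF le ennreal_less_top] by (intro integrableI_nonneg) auto
  then have int1: "integrable M (\<lambda>\<omega>. norm (X k \<omega>))" for k
    by (rule square_integrable_imp_integrable[rotated]) measurable
  have E2: "expectation (\<lambda>\<omega>. (norm (X k \<omega>))\<^sup>2) \<le> a k" for k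
    using le[of k] a(1)[of k] nn_integral_eq_integral[OF int2[of k]] by simp
  have lim2: "(\<lambda>k. expectation (\<lambda>\<omega>. (norm (X k \<omega>))\<^sup>2)) \<longlonglongrightarrow> 0"
    by (rule tendsto_sandwich[OF _ _ tendsto_const a(2)]) (simp_all add: E2)
  then show "(\<lambda>k. expectation (\<lambda>\<omega>. norm (outer (X k \<omega>)))) \<longlonglongrightarrow> 0"
    by (simp add: norm_outer)
  \<comment> \<open>Nonnegativity of the variance of the norm bounds the first moment by the root of
    the second.\<close>
  have le1: "expectation (\<lambda>\<omega>. norm (X k \<omega>)) \<le> sqrt (expectation (\<lambda>\<omega>. (norm (X k \<omega>))\<^sup>2))" for k
    using variance_eq[OF int1[of k] int2[of k]] variance_positive[of "\<lambda>\<omega>. norm (X k \<omega>)"]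
    by (intro real_le_rsqrt) simp
  have lim1: "(\<lambda>k. sqrt (expectation (\<lambda>\<omega>. (norm (X k \<omega>))\<^sup>2))) \<longlonglongrightarrow> 0"
    using tendsto_real_sqrt[OF lim2] by simp
  show "(\<lambda>k. expectation (\<lambda>\<omega>. norm (X k \<omega>))) \<longlonglongrightarrow> 0"
    by (rule tendsto_sandwich[OF _ _ tendsto_const lim1]) (simp_all add: le1)
qed

text \<open>Coercivity of \<open>V\<close> turns its geometric decay into decay of the second
  moment, uniformly in the initial mode and hence after averaging over any initial
  distribution.\<close>

lemma (in dissipative_jump_system) mean_square_stable:
  assumes "r < 1" and c: "c > 0" "\<And>x. c * (x \<bullet> x) \<le> V x"
  shows "mean_square_stable M \<sigma> K A B"
  unfolding mean_square_stable_def Let_def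
proof (intro allI impI)
  fix x0 :: "real^'x" and \<mu> :: "'m pmf"
  let ?P = "measure_pmf \<mu> \<Otimes>\<^sub>M M"
  let ?X = "\<lambda>k (i, \<omega>). jump_state A B ((\<lambda>l. \<sigma> l \<omega>)(0 := i)) (\<lambda>_. 0) x0 k"
  interpret \<mu>: prob_space "measure_pmf \<mu>" by (rule prob_space_measure_pmf)
  interpret P: pair_prob_space "measure_pmf \<mu>" M ..
  \<comment> \<open>Summing over all modes bounds the energy at time 1 whatever the initial mode
    is.\<close>
  define v where "v = (\<Sum>i\<in>UNIV. V (A i *v x0))"
  have "0 \<le> v" by (simp add: v_def sum_nonneg V_nonneg)
  \<comment> \<open>There are only countably many initial modes, so joint measurability follows from
    measurability for each fixed one.\<close>
  have meas: "?X k \<in> borel_measurable ?P" for k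
  proof -
    have "?X k \<in> borel_measurable (count_space UNIV \<Otimes>\<^sub>M M)"
      using measurable_compose[OF jump_state_measurable[of \<sigma>, OF mode_measurable], of "\<lambda>x. x" borel]
      by (intro measurable_pair_measure_countable1) (auto intro: countable_finite)
    also have "measurable (count_space UNIV \<Otimes>\<^sub>M M) borel = borel_measurable ?P"
      by (intro measurable_cong_sets sets_pair_measure_cong) auto
    finally show ?thesis .
  qed
  have bound: "(\<integral>\<^sup>+y. ennreal ((norm (?X (Suc k) y))\<^sup>2) \<partial>?P) \<le> ennreal (r ^ k * (v / c))" for k
  proof -
    have "(\<integral>\<^sup>+\<omega>. ennreal ((norm (?X (Suc k) (i, \<omega>)))\<^sup>2) \<partial>M) \<le> ennreal (r ^ k * (v / c))" for i
    proof -
      have "(\<integral>\<^sup>+\<omega>. ennreal ((norm (?X (Suc k) (i, \<omega>)))\<^sup>2) \<partial>M)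
          \<le> (\<integral>\<^sup>+\<omega>. ennreal (1 / c) * ennreal (V (?X (Suc k) (i, \<omega>))) \<partial>M)"
        using c V_nonneg
        by (intro nn_integral_mono)
          (simp add: ennreal_mult[symmetric] field_simps dot_square_norm del: jump_state.simps)
      also have "\<dots> = ennreal (1 / c) * (\<integral>\<^sup>+\<omega>. ennreal (V (?X (Suc k) (i, \<omega>))) \<partial>M)"
        unfolding prod.case
        by (intro nn_integral_cmult state_measurable_mode[where f="\<lambda>m x. ennreal (V x)"]) simp
      also have "\<dots> \<le> ennreal (1 / c) * ennreal (r ^ k * V (A i *v x0))"
        using energy_decay[of "\<lambda>_. 0" i x0 k] by (intro mult_left_mono) simp_all
      also have "\<dots> = ennreal (r ^ k * (V (A i *v x0) / c))"
        using c r V_nonneg by (simp add: ennreal_mult[symmetric])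
      also have "\<dots> \<le> ennreal (r ^ k * (v / c))"
        unfolding v_def using c r V_nonneg
        by (intro ennreal_leI mult_left_mono divide_right_mono member_le_sum) auto
      finally show ?thesis .
    qed
    then have "(\<integral>\<^sup>+i. \<integral>\<^sup>+\<omega>. ennreal ((norm (?X (Suc k) (i, \<omega>)))\<^sup>2) \<partial>M \<partial>measure_pmf \<mu>)
        \<le> (\<integral>\<^sup>+i. ennreal (r ^ k * (v / c)) \<partial>measure_pmf \<mu>)"
      by (intro nn_integral_mono)
    also have "\<dots> = ennreal (r ^ k * (v / c))" by simp
    finally show ?thesis
      by (subst nn_integral_fst[symmetric]) (use meas in measurable)
  qed
  have "(\<lambda>k. r ^ k * (v / c)) \<longlonglongrightarrow> 0"
    using \<open>r < 1\<close> r by (intro tendsto_mult_left_zero LIMSEQ_power_zero) simp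
  moreover have "0 \<le> r ^ k * (v / c)" for k
    using r c \<open>0 \<le> v\<close> by simp
  ultimately have "(\<lambda>k. P.expectation (\<lambda>y. norm (?X (Suc k) y))) \<longlonglongrightarrow> 0 \<and>
    (\<lambda>k. P.expectation (\<lambda>y. norm (outer (?X (Suc k) y)))) \<longlonglongrightarrow> 0"
    by (intro conjI P.second_moment_tendsto_zero[where X="\<lambda>k. ?X (Suc k)" and
          a="\<lambda>k. r ^ k * (v / c)", OF meas bound])
  \<comment> \<open>The bounds start at time 1; shifting the index leaves the limits
    unchanged.\<close>
  then show "(\<lambda>k. P.expectation (\<lambda>y. norm (?X k y))) \<longlonglongrightarrow> 0 \<and>
    (\<lambda>k. P.expectation (\<lambda>y. norm (outer (?X k y)))) \<longlonglongrightarrow> 0"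
    by (elim conjE) (intro conjI; rule LIMSEQ_imp_Suc; assumption)
qed

section \<open>Mean-square stability and the $H_2$-norm\<close>

lemma inner_transpose_matrix_vector_mult:
  fixes A :: "real^'a^'b"
  shows "v \<bullet> (transpose A *v u) = (A *v v) \<bullet> u"
  by (metis dot_lmul_matrix vector_transpose_matrix)

lemma inner_congruence:
  fixes A :: "real^'a^'b"
  shows "v \<bullet> ((transpose A ** Q ** A) *v v) = (A *v v) \<bullet> (Q *v (A *v v))"
    and "v \<bullet> ((transpose A ** A) *v v) = (A *v v) \<bullet> (A *v v)"
  by (simp_all add: matrix_vector_mul_assoc[symmetric] inner_transpose_matrix_vector_mult
      del: transpose_matrix_vector)

text \<open>By compactness the form of \<open>P\<close> has a positive minimum \<open>m\<close> on
  the unit sphere, while the form of \<open>Q\<close> is bounded there by the operator norm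
  \<open>b\<close>; \<open>m / (b + 1)\<close> serves as constant, the 1 covering
  \<open>b = 0\<close>.\<close>

lemma positive_form_dominates:
  fixes P Q :: "real^'a^'a"
  assumes P: "\<And>v. v \<noteq> 0 \<Longrightarrow> v \<bullet> (P *v v) > 0"
  obtains \<delta> where "\<delta> > 0" "\<And>v. \<delta> * (v \<bullet> (Q *v v)) \<le> v \<bullet> (P *v v)"
proof -
  let ?K = "sphere (0 :: real^'a) 1"
  have "axis undefined 1 \<in> ?K" by (simp add: norm_axis_1)
  then have "?K \<noteq> {}" by blast
  moreover have "continuous_on ?K (\<lambda>v. v \<bullet> (P *v v))"
    by (intro continuous_intros)
  ultimately obtain u where u: "u \<in> ?K" "\<And>v. v \<in> ?K \<Longrightarrow> u \<bullet> (P *v u) \<le> v \<bullet> (P *v v)"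
    using continuous_attains_inf[OF compact_sphere, of 0 1 "\<lambda>v. v \<bullet> (P *v v)"] by blast
  define m where "m = u \<bullet> (P *v u)"
  have "m > 0" unfolding m_def using u(1) by (intro P) auto
  have lower: "m * (norm v)\<^sup>2 \<le> v \<bullet> (P *v v)" for v
  proof (cases "v = 0")
    case False
    then have "v /\<^sub>R norm v \<in> ?K" by simp
    from u(2)[OF this] have "m \<le> (v \<bullet> (P *v v)) / (norm v)\<^sup>2"
      by (simp add: m_def matrix_vector_mult_scaleR power2_eq_square divide_inverse mult_ac)
    with False show ?thesis by (simp add: field_simps)
  qed simp
  define b where "b = onorm ((*v) Q)"
  have "bounded_linear ((*v) Q)" by (rule matrix_vector_mul_bounded_linear)
  then have b: "0 \<le> b" "norm (Q *v v) \<le> b * norm v" for v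
    unfolding b_def by (rule onorm_pos_le, rule onorm)
  have upper: "v \<bullet> (Q *v v) \<le> (b + 1) * (norm v)\<^sup>2" for v
  proof -
    have "v \<bullet> (Q *v v) \<le> norm v * norm (Q *v v)" by (rule norm_cauchy_schwarz)
    also have "\<dots> \<le> norm v * (b * norm v)" using b(2) by (intro mult_left_mono) auto
    also have "\<dots> \<le> (b + 1) * (norm v)\<^sup>2" by (simp add: power2_eq_square algebra_simps)
    finally show ?thesis .
  qed
  have "m / (b + 1) * (v \<bullet> (Q *v v)) \<le> v \<bullet> (P *v v)" for v
  proof -
    have "m / (b + 1) * (v \<bullet> (Q *v v)) \<le> m / (b + 1) * ((b + 1) * (norm v)\<^sup>2)"
      using \<open>m > 0\<close> b(1) by (intro mult_left_mono upper) auto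
    also have "\<dots> = m * (norm v)\<^sup>2" using b(1) by (simp add: field_simps)
    finally show ?thesis using lower[of v] by simp
  qed
  moreover have "m / (b + 1) > 0" using \<open>m > 0\<close> b(1) by simp
  ultimately show ?thesis using that by blast
qed

text \<open>A unit impulse at entry \<open>a\<close> of block \<open>i\<close> has modal coordinate
  \<open>U $ m $ i\<close> times the basis vector of \<open>a\<close>. Each diagonal entry of
  \<open>Z m\<close> thus receives the squared norm of row \<open>m\<close> of \<open>U\<close> as
  its weight, which is 1.\<close>

lemma sum_modal_axis:
  fixes U :: "real^'n^'n" and Z :: "'n \<Rightarrow> real^'w^'w"
  assumes "orthogonal_matrix U"
  shows "(\<Sum>s\<in>UNIV. \<Sum>m\<in>UNIV. modal U (block (axis s 1)) m \<bullet> (Z m *v modal U (block (axis s 1)) m)) =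
    (\<Sum>m\<in>UNIV. trace (Z m))"
proof -
  have block: "block (axis (i, a) 1 :: real^('n \<times> 'w)) j = (if i = j then axis a 1 else 0)" for i j and a :: 'w
    by (simp add: block_def axis_def vec_eq_iff)
  have modal: "modal U (block (axis (i, a) 1)) m = U $ m $ i *\<^sub>R axis a 1" for i m and a :: 'w
    by (simp add: modal_def block if_distrib[of "\<lambda>v. _ *\<^sub>R v"] cong: if_cong)
  have diag: "axis a 1 \<bullet> (Z m *v axis a 1) = Z m $ a $ a" for m a
    by (simp add: inner_axis' matrix_vector_mult_basis column_def)
  have "(U ** transpose U) $ m $ m = 1" for m
    using assms by (simp add: orthogonal_matrix_def mat_def)
  then have row: "(\<Sum>i\<in>UNIV. U $ m $ i * U $ m $ i) = 1" for m
    by (simp add: matrix_matrix_mult_def transpose_def)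
  have "(\<Sum>s\<in>UNIV. \<Sum>m\<in>UNIV. modal U (block (axis s 1)) m \<bullet> (Z m *v modal U (block (axis s 1)) m)) =
      (\<Sum>i\<in>UNIV. \<Sum>a\<in>UNIV. \<Sum>m\<in>UNIV. U $ m $ i * U $ m $ i * Z m $ a $ a)"
    by (simp add: sum_UNIV_prod modal matrix_vector_mult_scaleR diag mult.assoc)
  also have "\<dots> = (\<Sum>i\<in>UNIV. \<Sum>m\<in>UNIV. U $ m $ i * U $ m $ i * trace (Z m))"
    by (intro sum.cong refl, subst sum.swap) (simp add: trace_def sum_distrib_left)
  also have "\<dots> = (\<Sum>m\<in>UNIV. (\<Sum>i\<in>UNIV. U $ m $ i * U $ m $ i) * trace (Z m))"
    by (subst sum.swap) (simp add: sum_distrib_right)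
  finally show ?thesis by (simp add: row)
qed

text \<open>The quadratic form of the identity tensor \<open>Q\<close>: one common \<open>Q\<close>
  for all agents.\<close>

definition block_form :: "real^'x^'x \<Rightarrow> real^('n::finite \<times> 'x::finite) \<Rightarrow> real"
  where "block_form Q x = (\<Sum>i\<in>UNIV. block x i \<bullet> (Q *v block x i))"

lemma block_form_mat_1: "block_form (mat 1) x = x \<bullet> x"
  by (simp add: block_form_def inner_eq_sum_block)

text \<open>The output term is the same kind of form with weight \<open>mat 1\<close>, so one
  formula handles both summands. The matrices are generic: the lemma is used for \<open>A\<close>,
  \<open>C\<close> acting on states and for \<open>B\<close>, \<open>D\<close> acting on
  impulses.\<close>

lemma (in bernoulli_packet_loss) expectation_block_forms:
  fixes Fd Fc :: "real^'b^'x" and Hd Hc :: "real^'b^'z" and x :: "real^('n \<times> 'b)"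
    and Q :: "real^'x^'x" and U :: "real^'n^'n"
  assumes "irrefl E" "sym E" and Q: "transpose Q = Q"
    and U: "orthogonal_matrix U" "\<And>m. laplacian E *v row m U = lam m *\<^sub>R row m U"
    and F: "\<And>m. F m = Fd + (p * lam m) *\<^sub>R Fc" and H: "\<And>m. H m = Hd + (p * lam m) *\<^sub>R Hc"
  shows "expectation (\<lambda>\<omega>. block_form Q (decomposable Fd Fc (active_edges E \<alpha> k \<omega>) *v x)
      + (decomposable Hd Hc (active_edges E \<alpha> k \<omega>) *v x) \<bullet> (decomposable Hd Hc (active_edges E \<alpha> k \<omega>) *v x)) =
    (\<Sum>m\<in>UNIV. modal U (block x) m \<bullet> ((transpose (F m) ** Q ** F m + transpose (H m) ** H m
      + (2 * p * (1 - p) * lam m) *\<^sub>R (transpose Fc ** Q ** Fc + transpose Hc ** Hc)) *v modal U (block x) m))"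
    (is "_ = ?R")
proof -
  note * = expectation_quadratic_form_decomposable[OF assms(1,2) _ U, folded block_form_def]
  have "expectation (\<lambda>\<omega>. block_form Q (decomposable Fd Fc (active_edges E \<alpha> k \<omega>) *v x)
      + block_form (mat 1) (decomposable Hd Hc (active_edges E \<alpha> k \<omega>) *v x)) =
    expectation (\<lambda>\<omega>. block_form Q (decomposable Fd Fc (active_edges E \<alpha> k \<omega>) *v x))
      + expectation (\<lambda>\<omega>. block_form (mat 1) (decomposable Hd Hc (active_edges E \<alpha> k \<omega>) *v x))"
    by (intro Bochner_Integration.integral_add
        integrable_finite_valued[OF active_edges_measurable, where f="\<lambda>A. block_form _ (decomposable _ _ A *v x)"])
  also have "\<dots> = ?R"
    unfolding *[OF Q] *[OF transpose_mat] F[symmetric] H[symmetric]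
    by (simp add: matrix_vector_mult_add_rdistrib scaleR_matrix_vector_assoc[symmetric]
        inner_congruence inner_add_right sum.distrib[symmetric] algebra_simps)
  finally show ?thesis by (simp add: block_form_mat_1)
qed

theorem theorem7:
  fixes E0 :: "('n::finite \<times> 'n) set"
    and M :: "'a measure"
    and \<alpha> :: "'n \<times> 'n \<Rightarrow> nat \<Rightarrow> 'a \<Rightarrow> bool"
    and p \<gamma> :: real
    and lam :: "'n \<Rightarrow> real"
    and Ad Ac :: "real^'x^'x"
    and Bd Bc :: "real^'w^'x"
    and Cd Cc :: "real^'x^'z"
    and Dd Dc :: "real^'w^'z"
    and Abar :: "'n \<Rightarrow> real^'x^'x"
    and Bbar :: "'n \<Rightarrow> real^'w^'x"
    and Cbar :: "'n \<Rightarrow> real^'x^'z"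
    and Dbar :: "'n \<Rightarrow> real^'w^'z"
  assumes Abar: "\<And>i. Abar i = Ad + (p * lam i) *\<^sub>R Ac"
    and Bbar: "\<And>i. Bbar i = Bd + (p * lam i) *\<^sub>R Bc"
    and Cbar: "\<And>i. Cbar i = Cd + (p * lam i) *\<^sub>R Cc"
    and Dbar: "\<And>i. Dbar i = Dd + (p * lam i) *\<^sub>R Dc"
    and graph: "irrefl E0" "sym E0"
    and p: "0 \<le> p" "p \<le> 1"
    and gamma: "\<gamma> > 0"
    and packet_loss: "bernoulli_packet_loss M E0 p \<alpha>"
    and eigenvalues: "eigenvalue_family (laplacian E0) lam"
    and lmi: "\<exists>(Q :: real^'x^'x) (Z :: 'n \<Rightarrow> real^'w^'w).
      pos_definite Q \<and> (\<forall>i. transpose (Z i) = Z i) \<and> (\<Sum>i\<in>UNIV. trace (Z i)) < \<gamma>\<^sup>2 \<and>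
      (\<forall>i.
        neg_definite (transpose (Abar i) ** Q ** Abar i + transpose (Cbar i) ** Cbar i - Q
          + (2 * p * (1 - p) * lam i) *\<^sub>R (transpose Ac ** Q ** Ac + transpose Cc ** Cc)) \<and>
        neg_definite (transpose (Bbar i) ** Q ** Bbar i + transpose (Dbar i) ** Dbar i - Z i
          + (2 * p * (1 - p) * lam i) *\<^sub>R (transpose Bc ** Q ** Bc + transpose Dc ** Dc)))"
  shows "mean_square_stable M (active_edges E0 \<alpha>) (Pow E0)
      (decomposable Ad Ac) (decomposable Bd Bc) \<and>
    h2_norm M (active_edges E0 \<alpha>) (Pow E0)
      (decomposable Ad Ac) (decomposable Bd Bc) (decomposable Cd Cc) (decomposable Dd Dc)
      < ennreal \<gamma>"
proof -
  interpret bernoulli_packet_loss M E0 p \<alpha> by (rule packet_loss)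
  let ?A = "decomposable Ad Ac" and ?B = "decomposable Bd Bc"
    and ?C = "decomposable Cd Cc" and ?D = "decomposable Dd Dc"
  let ?\<sigma> = "active_edges E0 \<alpha>"
  obtain Q :: "real^'x^'x" and Z :: "'n \<Rightarrow> real^'w^'w" where
    Q: "pos_definite Q" and trZ: "(\<Sum>i\<in>UNIV. trace (Z i)) < \<gamma>\<^sup>2" and
    lmi_A: "\<And>i. neg_definite (transpose (Abar i) ** Q ** Abar i + transpose (Cbar i) ** Cbar i - Q
          + (2 * p * (1 - p) * lam i) *\<^sub>R (transpose Ac ** Q ** Ac + transpose Cc ** Cc))" and
    lmi_B: "\<And>i. neg_definite (transpose (Bbar i) ** Q ** Bbar i + transpose (Dbar i) ** Dbar i - Z i
          + (2 * p * (1 - p) * lam i) *\<^sub>R (transpose Bc ** Q ** Bc + transpose Dc ** Dc))"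
    using lmi by blast
  have symQ: "transpose Q = Q" and posQ: "v \<noteq> 0 \<Longrightarrow> v \<bullet> (Q *v v) > 0" for v
    using Q by (auto simp: pos_definite_def)
  have nonnegQ: "0 \<le> v \<bullet> (Q *v v)" for v
    using posQ[of v] by (cases "v = 0") auto
  obtain U :: "real^'n^'n" where U: "orthogonal_matrix U"
    "\<And>m. laplacian E0 *v row m U = lam m *\<^sub>R row m U"
    using eigenvalue_family_orthonormal_eigenvectors[OF transpose_laplacian[OF graph(2)] eigenvalues]
    by blast
  \<comment> \<open>\<open>MA\<close> and \<open>MB\<close> are the matrices of the two inequalities
    without \<open>- Q\<close> and \<open>- Z i\<close>, which are exactly those produced by
    \<open>expectation_block_forms\<close>.\<close>
  define MA where "MA i = transpose (Abar i) ** Q ** Abar i + transpose (Cbar i) ** Cbar i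
    + (2 * p * (1 - p) * lam i) *\<^sub>R (transpose Ac ** Q ** Ac + transpose Cc ** Cc)" for i
  define MB where "MB i = transpose (Bbar i) ** Q ** Bbar i + transpose (Dbar i) ** Dbar i
    + (2 * p * (1 - p) * lam i) *\<^sub>R (transpose Bc ** Q ** Bc + transpose Dc ** Dc)" for i
  have MA: "v \<noteq> 0 \<Longrightarrow> v \<bullet> ((Q - MA i) *v v) > 0" for v i
    using lmi_A[of i, unfolded neg_definite_def, THEN conjunct2, rule_format, of v] unfolding MA_def
    by (simp add: matrix_vector_mult_diff_rdistrib matrix_vector_mult_add_rdistrib inner_diff inner_add)
  have MB: "v \<bullet> (MB i *v v) \<le> v \<bullet> (Z i *v v)" for v i
    using lmi_B[of i, unfolded neg_definite_def, THEN conjunct2, rule_format, of v] unfolding MB_def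
    by (cases "v = 0")
      (simp_all add: matrix_vector_mult_diff_rdistrib matrix_vector_mult_add_rdistrib inner_diff inner_add)
  have "\<exists>\<delta>>0. \<forall>v. \<delta> * (v \<bullet> (Q *v v)) \<le> v \<bullet> ((Q - MA i) *v v)" for i
    using positive_form_dominates[where P="Q - MA i" and Q=Q, OF MA] by metis
  then obtain d where d: "\<And>i. d i > 0"
    "\<And>i v. d i * (v \<bullet> (Q *v v)) \<le> v \<bullet> ((Q - MA i) *v v)"
    by metis
  \<comment> \<open>Strictness of the inequalities, made uniform over the finitely many eigenvalues;
    the cap at 1 keeps the decay rate \<open>1 - \<delta>\<close> nonnegative.\<close>
  define \<delta> where "\<delta> = min 1 (Min (range d))"
  have \<delta>: "0 < \<delta>" "\<delta> \<le> 1" "\<And>i. \<delta> \<le> d i"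
    using d(1) by (auto simp: \<delta>_def min.coboundedI2)
  have decr: "v \<bullet> (MA i *v v) \<le> (1 - \<delta>) * (v \<bullet> (Q *v v))" for v i
    using d(2)[of i v] mult_right_mono[OF \<delta>(3)[of i] nonnegQ[of v]]
    by (simp add: matrix_vector_mult_diff_rdistrib inner_diff left_diff_distrib)
  let ?V = "block_form Q :: real^('n \<times> 'x) \<Rightarrow> real"
  have V_nonneg: "0 \<le> ?V x" for x
    by (simp add: block_form_def sum_nonneg nonnegQ)
  have E_A: "expectation (\<lambda>\<omega>. ?V (?A (?\<sigma> k \<omega>) *v x) + (?C (?\<sigma> k \<omega>) *v x) \<bullet> (?C (?\<sigma> k \<omega>) *v x))
      \<le> (1 - \<delta>) * ?V x" for k x
  proof -
    have "expectation (\<lambda>\<omega>. ?V (?A (?\<sigma> k \<omega>) *v x) + (?C (?\<sigma> k \<omega>) *v x) \<bullet> (?C (?\<sigma> k \<omega>) *v x))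
      = (\<Sum>m\<in>UNIV. modal U (block x) m \<bullet> (MA m *v modal U (block x) m))"
      unfolding MA_def by (rule expectation_block_forms[OF graph symQ U Abar Cbar])
    also have "\<dots> \<le> (\<Sum>m\<in>UNIV. (1 - \<delta>) * (modal U (block x) m \<bullet> (Q *v modal U (block x) m)))"
      by (intro sum_mono decr)
    also have "\<dots> = (1 - \<delta>) * ?V x"
      unfolding sum_distrib_left[symmetric] sum_quadratic_form_modal[OF U(1)] block_form_def ..
    finally show ?thesis .
  qed
  interpret dissipative_jump_system M ?\<sigma> ?A ?B ?C ?D ?V "1 - \<delta>"
  proof
    fix k x
    let ?f = "\<lambda>e. ?V (?A e *v x) + (?C e *v x) \<bullet> (?C e *v x)"
    have "(\<integral>\<^sup>+\<omega>. ennreal (?V (?A (?\<sigma> k \<omega>) *v x)) +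
        ennreal ((?C (?\<sigma> k \<omega>) *v x) \<bullet> (?C (?\<sigma> k \<omega>) *v x)) \<partial>M) = (\<integral>\<^sup>+\<omega>. ennreal (?f (?\<sigma> k \<omega>)) \<partial>M)"
      by (simp add: ennreal_plus V_nonneg)
    also have "\<dots> = ennreal (expectation (\<lambda>\<omega>. ?f (?\<sigma> k \<omega>)))"
      by (intro nn_integral_eq_integral integrable_finite_valued[where f="?f"] active_edges_measurable)
        (simp add: V_nonneg)
    also have "\<dots> \<le> ennreal ((1 - \<delta>) * ?V x)"
      by (intro ennreal_leI E_A)
    finally show "(\<integral>\<^sup>+\<omega>. ennreal (?V (?A (?\<sigma> k \<omega>) *v x)) +
        ennreal ((?C (?\<sigma> k \<omega>) *v x) \<bullet> (?C (?\<sigma> k \<omega>) *v x)) \<partial>M) \<le> ennreal ((1 - \<delta>) * ?V x)" .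
  qed (use indep_time V_nonneg \<delta> in auto)
  \<comment> \<open>Comparing \<open>Q\<close> with the identity gives the coercivity constant of
    the Lyapunov function.\<close>
  obtain c where c: "c > 0" "\<And>v. c * (v \<bullet> (mat 1 *v v)) \<le> v \<bullet> (Q *v v)"
    using positive_form_dominates[OF posQ] by blast
  have "c * (x \<bullet> x) \<le> ?V x" for x
    unfolding block_form_def inner_eq_sum_block[of x x] sum_distrib_left
    using c(2) by (intro sum_mono) simp
  then have stable: "mean_square_stable M ?\<sigma> (Pow E0) ?A ?B"
    using \<delta>(1) by (intro mean_square_stable[OF _ c(1)]) auto

  \<comment> \<open>The bound of \<open>output_energy_le\<close> for impulse \<open>s\<close> and
    initial mode \<open>e\<close>: stored energy at time 1 plus output energy at time 0.\<close>
  define g where "g e s = ?V (?B e *v axis s 1) + (?D e *v axis s 1) \<bullet> (?D e *v axis s 1)" for e s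
  have g_nonneg: "0 \<le> g e s" for e s
    by (simp add: g_def V_nonneg)
  have energy: "output_energy M (\<lambda>k \<omega>. jump_output ?A ?B ?C ?D ((\<lambda>l. ?\<sigma> l \<omega>)(0 := e)) (impulse s) 0 k)
      \<le> ennreal (g e s)" for e s
    using output_energy_le[of "impulse s" e 0] by (simp add: g_def impulse_def)
  have "h2_norm_squared M ?\<sigma> (Pow E0) ?A ?B ?C ?D
      \<le> (\<Sum>e\<in>Pow E0. \<Sum>s\<in>UNIV. ennreal (prob {\<omega> \<in> space M. ?\<sigma> 0 \<omega> = e}) * ennreal (g e s))"
    unfolding h2_norm_squared_def by (intro sum_mono mult_left_mono energy) simp
  also have "\<dots> = ennreal (\<Sum>e\<in>Pow E0. \<Sum>s\<in>UNIV. prob {\<omega> \<in> space M. ?\<sigma> 0 \<omega> = e} * g e s)"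
    by (simp add: ennreal_mult[symmetric] g_nonneg sum_ennreal sum_nonneg)
  also have "\<dots> \<le> ennreal (\<Sum>i\<in>UNIV. trace (Z i))"
  proof (rule ennreal_leI)
    \<comment> \<open>Extending the nonnegative sum to all sets of edges makes it an expectation
      over the mode at time 0, to which the second inequality applies.\<close>
    have "(\<Sum>e\<in>Pow E0. \<Sum>s\<in>UNIV. prob {\<omega> \<in> space M. ?\<sigma> 0 \<omega> = e} * g e s)
        \<le> (\<Sum>e\<in>UNIV. \<Sum>s\<in>UNIV. prob {\<omega> \<in> space M. ?\<sigma> 0 \<omega> = e} * g e s)"
      by (intro sum_mono2) (auto intro!: sum_nonneg mult_nonneg_nonneg g_nonneg)
    also have "\<dots> = (\<Sum>s\<in>UNIV. expectation (\<lambda>\<omega>. g (?\<sigma> 0 \<omega>) s))"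
      unfolding expectation_finite_valued[OF active_edges_measurable, of "\<lambda>e. g e _"]
      by (rule sum.swap)
    also have "\<dots> = (\<Sum>s\<in>UNIV. \<Sum>m\<in>UNIV. modal U (block (axis s 1)) m \<bullet> (MB m *v modal U (block (axis s 1)) m))"
      unfolding g_def MB_def
      by (intro sum.cong refl expectation_block_forms[OF graph symQ U Bbar Dbar])
    also have "\<dots> \<le> (\<Sum>s\<in>UNIV. \<Sum>m\<in>UNIV. modal U (block (axis s 1)) m \<bullet> (Z m *v modal U (block (axis s 1)) m))"
      by (intro sum_mono MB)
    also have "\<dots> = (\<Sum>i\<in>UNIV. trace (Z i))"
      by (rule sum_modal_axis[OF U(1)])
    finally show "(\<Sum>e\<in>Pow E0. \<Sum>s\<in>UNIV. prob {\<omega> \<in> space M. ?\<sigma> 0 \<omega> = e} * g e s)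
        \<le> (\<Sum>i\<in>UNIV. trace (Z i))" .
  qed
  finally have "h2_norm_squared M ?\<sigma> (Pow E0) ?A ?B ?C ?D \<le> ennreal (\<Sum>i\<in>UNIV. trace (Z i))" .
  also have "\<dots> < ennreal (\<gamma>\<^sup>2)"
    using trZ gamma by (simp add: ennreal_lessI)
  finally have less: "h2_norm_squared M ?\<sigma> (Pow E0) ?A ?B ?C ?D < ennreal (\<gamma>\<^sup>2)" .
  \<comment> \<open>Finiteness excludes the infinite branch of \<open>h2_norm\<close>, so the square
    root can be estimated over the reals.\<close>
  then have "h2_norm_squared M ?\<sigma> (Pow E0) ?A ?B ?C ?D \<noteq> \<infinity>" by auto
  moreover have "enn2real (h2_norm_squared M ?\<sigma> (Pow E0) ?A ?B ?C ?D) < \<gamma>\<^sup>2"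
    using less gamma by (cases "h2_norm_squared M ?\<sigma> (Pow E0) ?A ?B ?C ?D")
      (auto simp: ennreal_less_iff)
  then have "sqrt (enn2real (h2_norm_squared M ?\<sigma> (Pow E0) ?A ?B ?C ?D)) < \<gamma>"
    using gamma by (simp add: real_less_lsqrt)
  ultimately have "h2_norm M ?\<sigma> (Pow E0) ?A ?B ?C ?D < ennreal \<gamma>"
    using gamma by (simp add: h2_norm_def ennreal_lessI)
  with stable show ?thesis by blast
qed

end
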